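(* Let $1\le m\le q$ and let $\mathbf{P}_{m+1}=(P_\infty,P_1,\ldots,P_m)$ on the curve $\mathcal{Y}_{n,s}$. For $(i,j)\in\mathcal{I}$ and $k_2,\ldots,k_{m+1}\in\mathbb{Z}$ let $$\beta^{i,j,m}_{k_2,\ldots,k_{m+1}}:=\Big(\big(q^2-m-\textstyle\sum_{\ell=2}^{m+1}k_\ell\big)(q+1)M-iqM-jq^3,\ k_2(q+1)M+iM+j,\ \ldots,\ k_{m+1}(q+1)M+iM+j\Big)\in\mathbb{Z}^{m+1}.$$ Then $\Gamma(\mathbf{P}_{m+1})$ is the set of all $\beta^{i,j,m}_{k_2,\ldots,k_{m+1}}$ (with $(i,j)\in\mathcal{I}$ and $k_2,\ldots,k_{m+1}\in\mathbb{Z}$) that lie in $\mathbb{N}_0^{m+1}$.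
   Context: Let $q$ be a prime power, $n\ge 3$ an odd integer, $s$ a positive divisor of $\frac{q^n+1}{q+1}$, and $M=\frac{q^n+1}{s(q+1)}$. $\mathcal{Y}_{n,s}$ is the nonsingular projective geometrically irreducible curve over $\mathbb{F}_{q^{2n}}$ given by the affine equations $x^q+x=y^{q+1}$ and $y^{q^2}-y=z^M$. $P_\infty$ is the unique common pole of $x,y,z$; $\alpha_1,\ldots,\alpha_q$ are the distinct roots of $x^q+x$, and $P_i$ is the rational point $(x,y,z)=(\alpha_i,0,0)$, $1\le i\le q$. $\mathcal{I}:=\{(i,j)\in\mathbb{Z}^2: 0\le i\le q,\ 1\le j\le M\}\setminus\{(q,M)\}$; $\mathbb{N}_0$ is the set of nonnegative integers. Generalized Weierstrass semigroup: for an $r$-tuple $\mathbf{Q}=(Q_1,\ldots,Q_r)$ of distinct rational points on a curve, $\widehat{H}(\mathbf{Q})=\{(-v_{Q_1}(h),\ldots,-v_{Q_r}(h)) : h\ne 0 \text{ a rational function regular outside } \{Q_1,\ldots,Q_r\}\}\subseteq\mathbb{Z}^r$, where $v_Q$ is the discrete valuation at $Q$. For $\alpha\in\mathbb{Z}^r$ and nonempty $J\subsetneq\{1,\ldots,r\}$, $\nabla_J(\alpha):=\{\beta\in\widehat{H}(\mathbf{Q}):\beta_j=\alpha_j\ (j\in J),\ \beta_i<\alpha_i\ (i\notin J)\}$. An element $\alpha\in\widehat{H}(\mathbf{Q})$ is called absolute maximal if $\nabla_J(\alpha)=\emptyset$ for every $J\subsetneq\{1,\ldots,r\}$ with $\#J\ge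 2$. $\widehat{\Gamma}(\mathbf{Q})$ is the set of absolute maximal elements of $\widehat{H}(\mathbf{Q})$, and $\Gamma(\mathbf{Q})=\widehat{\Gamma}(\mathbf{Q})\cap\mathbb{N}_0^r$ is the minimal generating set of the Weierstrass semigroup $H(\mathbf{Q})$, the set of $(a_1,\ldots,a_r)\in\mathbb{N}_0^r$ for which some nonzero rational function has pole divisor $\sum_i a_iQ_i$.
   Formalization: Γ is taken without the zero vector, which by the stated definition lies in Γ-hat ∩ N_0^{m+1} but is never a β; absolute maximal elements must also satisfy ∇_J(α)=∅ for one-element J, which changes the notion only for m=1, where the stated condition is vacuous. *)

theory Defs
  imports
    "HOL-Number_Theory.Prime_Powers"
    "HOL-Computational_Algebra.Polynomial"
begin

text \<open>
  A nonsingular projective curve over a field \<open>K\<close> is represented by its function field, which is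
  the whole type \<open>'a\<close>, and its closed points by the normalized discrete valuations of
  \<open>'a\<close> that are trivial on \<open>K\<close>.
\<close>

definition is_subfield :: "'a::field set \<Rightarrow> bool" where
  "is_subfield K \<longleftrightarrow> 0 \<in> K \<and> 1 \<in> K \<and>
     (\<forall>a\<in>K. \<forall>b\<in>K. a - b \<in> K \<and> a * b \<in> K) \<and> (\<forall>a\<in>K. inverse a \<in> K)"

definition algebraic_over :: "'a::field set \<Rightarrow> 'a \<Rightarrow> bool" where
  "algebraic_over K a \<longleftrightarrow> (\<exists>p. p \<noteq> 0 \<and> (\<forall>i. coeff p i \<in> K) \<and> poly p a = 0)"

text \<open>
  The type \<open>'a\<close> is the function field \<open>K(x,y,z)\<close> of the curve \<open>Y\<^sub>n\<^sub>,\<^sub>s\<close> over the field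
  \<open>K\<close> with \<open>q\<^sup>2\<^sup>n\<close> elements. The element \<open>t\<close> makes the transcendence degree positive; by the
  two equations it is then one. As \<open>K\<close> is perfect, geometric irreducibility means that \<open>K\<close> is
  algebraically closed in the function field.
\<close>

definition Y_function_field ::
    "nat \<Rightarrow> nat \<Rightarrow> nat \<Rightarrow> 'a::field set \<Rightarrow> 'a \<Rightarrow> 'a \<Rightarrow> 'a \<Rightarrow> bool" where
  "Y_function_field q n M K x y z \<longleftrightarrow>
     is_subfield K \<and> card K = q ^ (2 * n) \<and>
     is_subfield hull (K \<union> {x, y, z}) = UNIV \<and>
     (\<exists>t. \<not> algebraic_over K t) \<and>
     (\<forall>a. algebraic_over K a \<longrightarrow> a \<in> K) \<and>
     x ^ q + x = y ^ (q + 1) \<and>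
     y ^ (q\<^sup>2) - y = z ^ M"

text \<open>
  The value at \<open>0\<close>, mathematically infinite, is set to the dummy value \<open>0\<close>, so that two
  valuations that agree on all nonzero elements are equal.
\<close>

definition place :: "'a::field set \<Rightarrow> ('a \<Rightarrow> int) \<Rightarrow> bool" where
  "place K v \<longleftrightarrow>
     v 0 = 0 \<and>
     (\<forall>a b. a \<noteq> 0 \<longrightarrow> b \<noteq> 0 \<longrightarrow> v (a * b) = v a + v b) \<and>
     (\<forall>a b. a \<noteq> 0 \<longrightarrow> b \<noteq> 0 \<longrightarrow> a + b \<noteq> 0 \<longrightarrow> min (v a) (v b) \<le> v (a + b)) \<and>
     (\<exists>t. t \<noteq> 0 \<and> v t = 1) \<and>
     (\<forall>c\<in>K. v c = 0)"

text \<open>Rational: the residue field is \<open>K\<close>.\<close>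

definition rational_place :: "'a::field set \<Rightarrow> ('a \<Rightarrow> int) \<Rightarrow> bool" where
  "rational_place K v \<longleftrightarrow>
     place K v \<and> (\<forall>f. 0 \<le> v f \<longrightarrow> (\<exists>c\<in>K. f = c \<or> 0 < v (f - c)))"

definition gen_semigroup :: "'a::field set \<Rightarrow> ('a \<Rightarrow> int) list \<Rightarrow> int list set" where
  "gen_semigroup K Q =
     {map (\<lambda>v. - v h) Q | h. h \<noteq> 0 \<and> (\<forall>v. place K v \<and> v \<notin> set Q \<longrightarrow> 0 \<le> v h)}"

text \<open>Coordinates are numbered from \<open>0\<close>, as list positions.\<close>

definition nabla ::
    "'a::field set \<Rightarrow> ('a \<Rightarrow> int) list \<Rightarrow> nat set \<Rightarrow> int list \<Rightarrow> int list set" where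
  "nabla K Q J \<alpha> =
     {\<beta> \<in> gen_semigroup K Q.
        (\<forall>j\<in>J. \<beta> ! j = \<alpha> ! j) \<and> (\<forall>i\<in>{..<length Q} - J. \<beta> ! i < \<alpha> ! i)}"

definition maximal_elem :: "'a::field set \<Rightarrow> ('a \<Rightarrow> int) list \<Rightarrow> int list \<Rightarrow> bool" where
  "maximal_elem K Q \<alpha> \<longleftrightarrow>
     \<alpha> \<in> gen_semigroup K Q \<and> (\<forall>i<length Q. nabla K Q {i} \<alpha> = {})"

text \<open>
  Absolute maximal elements are in particular maximal. For at least three rational points,
  the condition on the sets \<open>J\<close> with at least two elements already implies
  maximality; for two points there is no such \<open>J\<close>, and maximality is the entire condition.
\<close>

definition absolute_maximal :: "'a::field set \<Rightarrow> ('a \<Rightarrow> int) list \<Rightarrow> int list \<Rightarrow> bool" where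
  "absolute_maximal K Q \<alpha> \<longleftrightarrow>
     maximal_elem K Q \<alpha> \<and>
     (\<forall>J. J \<subset> {..<length Q} \<and> 2 \<le> card J \<longrightarrow> nabla K Q J \<alpha> = {})"

definition Gamma_hat :: "'a::field set \<Rightarrow> ('a \<Rightarrow> int) list \<Rightarrow> int list set" where
  "Gamma_hat K Q = {\<alpha>. absolute_maximal K Q \<alpha>}"

definition nonneg_vec :: "int list \<Rightarrow> bool" where
  "nonneg_vec \<alpha> \<longleftrightarrow> (\<forall>a\<in>set \<alpha>. 0 \<le> a)"

text \<open>
  The minimal generating set of the Weierstrass semigroup. The zero vector, attained by the
  constants, is absolute maximal; being the neutral element it is not counted as a generator.
\<close>

definition Gamma :: "'a::field set \<Rightarrow> ('a \<Rightarrow> int) list \<Rightarrow> int list set" where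
  "Gamma K Q = {\<alpha> \<in> Gamma_hat K Q. nonneg_vec \<alpha>} - {replicate (length Q) 0}"

definition index_set :: "nat \<Rightarrow> nat \<Rightarrow> (int \<times> int) set" where
  "index_set q M = ({0..int q} \<times> {1..int M}) - {(int q, int M)}"

text \<open>Only the values \<open>k 2, \<dots>, k (m + 1)\<close> matter.\<close>

definition beta_vec :: "nat \<Rightarrow> nat \<Rightarrow> nat \<Rightarrow> int \<Rightarrow> int \<Rightarrow> (nat \<Rightarrow> int) \<Rightarrow> int list" where
  "beta_vec q M m i j k =
     ((int q ^ 2 - int m - (\<Sum>l=2..m+1. k l)) * (int q + 1) * int M
        - i * int q * int M - j * int q ^ 3)
     # map (\<lambda>l. k l * (int q + 1) * int M + i * int M + j) [2..<m+2]"

end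

theory Submission
  imports Defs
begin

text \<open>
  Everything rests on one explicit description of functions by normal forms, in which values at
  the distinguished places can be read off. Let \<open>A = K[x, y, z]\<close>. The two equations of the curve
  eliminate \<open>y\<^bsup>q + 1\<^esup>\<close> and \<open>z\<^bsup>M\<^esup>\<close>, so every element of \<open>A\<close> is a sum of terms \<open>z\<^bsup>i\<^esup> y\<^bsup>j\<^esup> p(x)\<close> with
  \<open>i < M\<close> and \<open>j \<le> q\<close>. At a place \<open>v\<close> where \<open>x\<close> has a pole, the equations and \<open>gcd(q, M) = 1\<close>
  force the pole orders of \<open>x\<close>, \<open>y\<close>, \<open>z\<close> to be \<open>(q + 1) M\<close>, \<open>q M\<close>, \<open>q\<^sup>3\<close> up to a common factor,
  and at a zero of \<open>x - \<alpha>\<close> with \<open>\<alpha>\<^bsup>q\<^esup> + \<alpha> = 0\<close> the orders of \<open>x - \<alpha>\<close>, \<open>y\<close>, \<open>z\<close> are \<open>(q + 1) M\<close>,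
  \<open>M\<close>, \<open>1\<close> up to a common factor. In both cases the values of terms with distinct \<open>(i, j)\<close> are
  distinct modulo \<open>(q + 1) M\<close>. Hence the terms of a normal form cannot cancel, the common factor
  is \<open>1\<close>, and the place is unique (\<open>has_weights_normalized\<close>, \<open>has_weights_unique\<close>).

  The second ingredient is that a function with no pole outside infinity lies in \<open>A\<close>
  (\<open>regular_imp_in_A\<close>). The affine curve is unramified over the \<open>z\<close>-line, because \<open>y\<^bsup>q\<^sup>2\<^esup> - y\<close> and
  \<open>x\<^bsup>q\<^esup> + x\<close> are additive polynomials with nonzero linear term. Concretely, modulo an irreducible
  polynomial in \<open>z\<close> every element of \<open>A\<close> is fixed by some power of Frobenius (\<open>A_fixed\<close>), so the
  quotient is reduced, and the localization of \<open>A\<close> at a prime ideal containing that polynomial is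
  a discrete valuation ring. If \<open>f\<close> is not in \<open>A\<close>, its ideal of denominators lies in such a prime
  ideal and \<open>f\<close> has a pole there. The ideal contains a nonzero polynomial in \<open>z\<close> by a count of
  functions with bounded pole order at infinity (\<open>multiple_in_polys\<close>).

  Together these show (\<open>semigroup_decomposition\<close>) that a function with poles only at infinity and
  at \<open>P\<^sub>1, \<dots>, P\<^sub>m\<close> is a sum of terms \<open>z\<^bsup>i\<^esup> y\<^bsup>j\<^esup> r(x)\<close>, where \<open>r\<close> is a polynomial divided by powers
  of the \<open>x - \<alpha>\<^sub>l\<close>, and that its pole vector is the componentwise maximum of the pole vectors of
  the terms. The degree of \<open>r\<close> is at least the sum of its orders at the \<open>\<alpha>\<^sub>l\<close>, with equality
  exactly if \<open>r\<close> is a constant times a product of powers of the \<open>x - \<alpha>\<^sub>l\<close>. The absolute maximal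
  vectors are therefore those of the monomials \<open>z\<^bsup>i\<^esup> y\<^bsup>j\<^esup> \<Prod>\<^sub>l (x - \<alpha>\<^sub>l)\<^bsup>e l\<^esup>\<close>
  (\<open>monomial_absolute_maximal\<close>, \<open>absolute_maximal_imp_monomial\<close>), and a change of indices turns
  them into the vectors of the statement.
\<close>

section \<open>Valuations of sums\<close>

lemma place_mult: "place K v \<Longrightarrow> a \<noteq> 0 \<Longrightarrow> b \<noteq> 0 \<Longrightarrow> v (a * b) = v a + v b"
  unfolding place_def by blast

lemma place_zero: "place K v \<Longrightarrow> v 0 = 0"
  unfolding place_def by blast

lemma place_const: "place K v \<Longrightarrow> c \<in> K \<Longrightarrow> v c = 0"
  unfolding place_def by blast

lemma place_one: "place K v \<Longrightarrow> v 1 = 0"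
  using place_mult[of K v 1 1] by simp

lemma place_power: "place K v \<Longrightarrow> a \<noteq> 0 \<Longrightarrow> v (a ^ n) = int n * v a"
  by (induction n) (simp_all add: place_one place_mult algebra_simps)

lemma place_inverse: "place K v \<Longrightarrow> v (inverse a) = - v a"
proof (cases "a = 0")
  case False
  assume "place K v"
  then have "v (a * inverse a) = v a + v (inverse a)"
    using False by (intro place_mult) auto
  then show ?thesis
    using False place_one[OF \<open>place K v\<close>] by simp
qed (simp add: place_zero)

lemma place_divide: "place K v \<Longrightarrow> a \<noteq> 0 \<Longrightarrow> b \<noteq> 0 \<Longrightarrow> v (a / b) = v a - v b"
  by (simp add: divide_inverse place_mult place_inverse)

lemma place_powi: "place K v \<Longrightarrow> a \<noteq> 0 \<Longrightarrow> v (a powi k) = k * v a"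
  by (cases "k \<ge> 0") (simp_all add: power_int_def place_power place_inverse)

lemma place_uminus:
  assumes v: "place K v"
  shows "v (- a) = v a"
proof (cases "a = 0")
  case False
  have "v ((- 1) * (- 1)) = v (- 1) + v (- 1)"
    by (rule place_mult[OF v]) auto
  then have "v (- 1) = 0"
    using place_one[OF v] by simp
  then show ?thesis
    using place_mult[OF v, of "- 1" a] False by simp
qed simp

lemma place_prod: "place K v \<Longrightarrow> (\<And>i. i \<in> I \<Longrightarrow> f i \<noteq> 0) \<Longrightarrow> v (prod f I) = (\<Sum>i\<in>I. v (f i))"
proof (induction I rule: infinite_finite_induct)
  case (insert i I)
  then have "prod f I \<noteq> 0"
    by (simp add: prod_zero_iff)
  then show ?case
    using insert by (simp add: place_mult)
qed (simp_all add: place_one)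

text \<open>
  The sets \<open>{a. a = 0 \<or> k \<le> v a}\<close> are the fractional ideals of the valuation ring; the first
  alternative corrects the dummy value at \<open>0\<close>.
\<close>

lemma place_add_ge:
  assumes v: "place K v" and "a = 0 \<or> k \<le> v a" and "b = 0 \<or> k \<le> v b"
  shows "a + b = 0 \<or> k \<le> v (a + b)"
proof (cases "a = 0 \<or> b = 0 \<or> a + b = 0")
  case False
  then have "min (v a) (v b) \<le> v (a + b)"
    using v unfolding place_def by blast
  then show ?thesis
    using assms False by auto
qed (use assms in auto)

lemma place_sum_ge:
  assumes v: "place K v" and "\<And>i. i \<in> I \<Longrightarrow> f i = 0 \<or> k \<le> v (f i)"
  shows "sum f I = 0 \<or> k \<le> v (sum f I)"
  using assms(2)
proof (induction I rule: infinite_finite_induct)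
  case (insert i I)
  then show ?case
    using place_add_ge[OF v, of "f i" k "sum f I"] by auto
qed simp_all

lemma place_nonneg_add: "place K v \<Longrightarrow> 0 \<le> v a \<Longrightarrow> 0 \<le> v b \<Longrightarrow> 0 \<le> v (a + b)"
  using place_add_ge[of K v a 0 b] by (auto simp: place_zero)

lemma place_nonneg_mult: "place K v \<Longrightarrow> 0 \<le> v a \<Longrightarrow> 0 \<le> v b \<Longrightarrow> 0 \<le> v (a * b)"
  by (cases "a = 0 \<or> b = 0") (auto simp: place_zero place_mult)

lemma place_nonneg_power: "place K v \<Longrightarrow> 0 \<le> v a \<Longrightarrow> 0 \<le> v (a ^ n)"
  by (induction n) (auto simp: place_nonneg_mult place_one)

lemma place_add_less:
  assumes v: "place K v" and "a \<noteq> 0" and "b = 0 \<or> v a < v b"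
  shows "a + b \<noteq> 0" and "v (a + b) = v a"
proof -
  have "a + b \<noteq> 0 \<and> v (a + b) = v a"
  proof (cases "b = 0")
    case False
    have ne: "a + b \<noteq> 0"
      using assms False place_uminus[OF v, of b] by (auto simp: add_eq_0_iff)
    have "v a \<le> v (a + b)"
      using place_add_ge[OF v, of a "v a" b] assms ne by auto
    moreover have "\<not> v a + 1 \<le> v (a + b)"
      using place_add_ge[OF v, of "a + b" "v a + 1" "- b"] assms False
      by (auto simp: place_uminus[OF v])
    ultimately show ?thesis
      using ne by simp
  qed (use assms in auto)
  then show "a + b \<noteq> 0" "v (a + b) = v a"
    by auto
qed

text \<open>The strict triangle inequality: distinct values cannot cancel.\<close>

lemma place_sum_distinct:
  assumes v: "place K v" and "finite I" "I \<noteq> {}" and nz: "\<And>i. i \<in> I \<Longrightarrow> f i \<noteq> 0"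
    and inj: "inj_on (\<lambda>i. v (f i)) I"
  shows "sum f I \<noteq> 0"
    and "\<exists>i\<in>I. v (sum f I) = v (f i) \<and> (\<forall>j\<in>I. v (f i) \<le> v (f j))"
proof -
  have "Min ((\<lambda>i. v (f i)) ` I) \<in> (\<lambda>i. v (f i)) ` I"
    using assms by (intro Min_in) auto
  then obtain i where i: "i \<in> I" "v (f i) = Min ((\<lambda>i. v (f i)) ` I)"
    by auto
  have le: "v (f i) \<le> v (f j)" if "j \<in> I" for j
    using i \<open>finite I\<close> that by auto
  have "sum f (I - {i}) = 0 \<or> v (f i) + 1 \<le> v (sum f (I - {i}))"
  proof (rule place_sum_ge[OF v])
    fix j assume "j \<in> I - {i}"
    then have "v (f j) \<noteq> v (f i)" "v (f i) \<le> v (f j)"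
      using inj i le by (auto simp: inj_on_def)
    then show "f j = 0 \<or> v (f i) + 1 \<le> v (f j)"
      by auto
  qed
  then have "sum f (I - {i}) = 0 \<or> v (f i) < v (sum f (I - {i}))"
    by auto
  note * = place_add_less[OF v nz[OF i(1)] this]
  have "sum f I = f i + sum f (I - {i})"
    using \<open>finite I\<close> i by (simp add: sum.remove)
  with * le i(1) show "sum f I \<noteq> 0"
    and "\<exists>i\<in>I. v (sum f I) = v (f i) \<and> (\<forall>j\<in>I. v (f i) \<le> v (f j))"
    by (simp, metis)
qed


section \<open>Polynomials over the constant field\<close>

lemma sum_order_le_degree_subset:
  assumes "p \<noteq> 0" and "finite S"
  shows "(\<Sum>a\<in>S. order a p) \<le> degree p"
proof -
  have "(\<Sum>a\<in>S. order a p) = (\<Sum>a\<in>S \<inter> {a. poly p a = 0}. order a p)"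
    using assms by (intro sum.mono_neutral_right) (auto simp: order_root)
  also have "\<dots> \<le> (\<Sum>a | poly p a = 0. order a p)"
    using poly_roots_finite[OF assms(1)] by (intro sum_mono2) auto
  finally show ?thesis
    using sum_order_le_degree[OF assms(1)] by simp
qed

locale constant_field =
  fixes K :: "'a::field set"
  assumes K: "is_subfield K"
begin

lemma K_0: "0 \<in> K" and K_1: "1 \<in> K"
  and K_diff: "a \<in> K \<Longrightarrow> b \<in> K \<Longrightarrow> a - b \<in> K"
  and K_mult: "a \<in> K \<Longrightarrow> b \<in> K \<Longrightarrow> a * b \<in> K"
  and K_inverse: "a \<in> K \<Longrightarrow> inverse a \<in> K"
  using K unfolding is_subfield_def by auto

lemma K_uminus: "a \<in> K \<Longrightarrow> - a \<in> K"
  using K_diff[OF K_0] by simp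

lemma K_add: "a \<in> K \<Longrightarrow> b \<in> K \<Longrightarrow> a + b \<in> K"
  using K_diff[OF _ K_uminus, of a b] by simp

lemma K_divide: "a \<in> K \<Longrightarrow> b \<in> K \<Longrightarrow> a / b \<in> K"
  by (simp add: divide_inverse K_mult K_inverse)

definition polys :: "'a poly set" where
  "polys = {p. \<forall>i. coeff p i \<in> K}"

lemma polys_0: "0 \<in> polys"
  by (simp add: polys_def K_0)

lemma polys_pCons: "pCons c p \<in> polys \<longleftrightarrow> c \<in> K \<and> p \<in> polys"
proof
  assume *: "pCons c p \<in> polys"
  have "coeff p i \<in> K" for i
    using *[unfolded polys_def, simplified, rule_format, of "Suc i"] by simp
  moreover have "c \<in> K"
    using *[unfolded polys_def, simplified, rule_format, of 0] by simp
  ultimately show "c \<in> K \<and> p \<in> polys"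
    by (simp add: polys_def)
qed (auto simp: polys_def coeff_pCons split: nat.split)

lemma polys_1: "1 \<in> polys"
  by (simp add: one_pCons polys_pCons K_1 polys_0)

lemma polys_monom: "c \<in> K \<Longrightarrow> monom c n \<in> polys"
  by (auto simp: polys_def K_0)

lemma polys_add: "p \<in> polys \<Longrightarrow> r \<in> polys \<Longrightarrow> p + r \<in> polys"
  by (auto simp: polys_def K_add)

lemma polys_diff: "p \<in> polys \<Longrightarrow> r \<in> polys \<Longrightarrow> p - r \<in> polys"
  by (auto simp: polys_def K_diff)

lemma polys_smult: "c \<in> K \<Longrightarrow> p \<in> polys \<Longrightarrow> smult c p \<in> polys"
  by (auto simp: polys_def K_mult)

lemma polys_value: "p \<in> polys \<Longrightarrow> a \<in> K \<Longrightarrow> poly p a \<in> K"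
  by (induction p) (auto simp: polys_0 polys_pCons K_0 intro!: K_add K_mult)

lemma polys_synthetic_div: "p \<in> polys \<Longrightarrow> a \<in> K \<Longrightarrow> synthetic_div p a \<in> polys"
  by (induction p) (auto simp: polys_0 polys_pCons intro!: polys_value)

text \<open>
  Quotient and remainder exist with coefficients in \<open>K\<close> although the ambient type of coefficients
  is the whole function field.
\<close>

lemma polys_division:
  assumes g: "g \<in> polys" "g \<noteq> 0" and "p \<in> polys"
  shows "\<exists>s\<in>polys. \<exists>r\<in>polys. p = s * g + r \<and> (r = 0 \<or> degree r < degree g)"
  using assms(3)
proof (induction p)
  case 0
  show ?case
    by (rule bexI[OF _ polys_0], rule bexI[OF _ polys_0]) auto
next
  case (pCons c p)
  then have c: "c \<in> K" and "p \<in> polys"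
    by (auto simp: polys_pCons)
  with pCons.IH obtain s r where s: "s \<in> polys" "r \<in> polys" "p = s * g + r"
      "r = 0 \<or> degree r < degree g"
    by auto
  define d where "d = coeff (pCons c r) (degree g) / coeff g (degree g)"
  define r' where "r' = pCons c r - smult d g"
  have r1: "pCons c r \<in> polys"
    using c s by (simp add: polys_pCons)
  have d: "d \<in> K"
    unfolding d_def using r1 g by (intro K_divide) (auto simp: polys_def)
  have 1: "degree (pCons c r) \<le> degree g"
    using s(4) by (auto simp: degree_pCons_eq_if)
  have "coeff r' i = 0" if "degree g \<le> i" for i
  proof (cases "i = degree g")
    case True
    then show ?thesis
      using g by (simp add: r'_def d_def)
  next
    case False
    then have "degree g < i"
      using that by simp
    then have "coeff (pCons c r) i = 0" "coeff g i = 0"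
      using 1 by (intro coeff_eq_0; simp)+
    then show ?thesis
      by (simp add: r'_def)
  qed
  then have "r' = 0 \<or> degree r' < degree g"
    by (metis leading_coeff_0_iff not_less)
  moreover have "pCons c p = (pCons 0 s + [:d:]) * g + r'"
    by (simp add: s(3) r'_def algebra_simps)
  moreover have "pCons 0 s + [:d:] \<in> polys" "r' \<in> polys"
    unfolding r'_def using d s g r1
    by (auto simp: polys_pCons polys_0 K_0 intro!: polys_add polys_diff polys_smult)
  ultimately show ?case
    by blast
qed

lemma place_poly_nonneg:
  assumes v: "place K v" and "0 \<le> v a" and "p \<in> polys"
  shows "0 \<le> v (poly p a)"
  using assms(3)
  by (induction p) (auto simp: place_zero[OF v] place_const[OF v] polys_pCons assms
      intro!: place_nonneg_add[OF v] place_nonneg_mult[OF v])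

text \<open>At a pole of \<open>a\<close> the leading term dominates.\<close>

lemma place_poly_pole:
  assumes v: "place K v" and "v a < 0" and "p \<in> polys" "p \<noteq> 0"
  shows "poly p a \<noteq> 0 \<and> v (poly p a) = int (degree p) * v a"
  using assms(3,4)
proof (induction p)
  case (pCons c p)
  have a: "a \<noteq> 0"
    using \<open>v a < 0\<close> place_zero[OF v] by auto
  show ?case
  proof (cases "p = 0")
    case True
    then show ?thesis
      using pCons place_const[OF v] by (auto simp: polys_pCons)
  next
    case False
    then have IH: "poly p a \<noteq> 0" "v (poly p a) = int (degree p) * v a"
      using pCons by (auto simp: polys_pCons)
    then have *: "v (a * poly p a) = v a + int (degree p) * v a"
      using a by (simp add: place_mult[OF v])
    moreover have "int (degree p) * v a \<le> 0"
      using \<open>v a < 0\<close> by (intro mult_nonneg_nonpos) auto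
    ultimately have "c = 0 \<or> v (a * poly p a) < v c"
      using \<open>v a < 0\<close> pCons.prems place_const[OF v] by (auto simp: polys_pCons)
    from place_add_less[OF v _ this] show ?thesis
      using a IH * False by (simp add: algebra_simps)
  qed
qed simp

text \<open>
  Once all factors \<open>X - \<alpha>\<close> are split off, the remaining polynomial is congruent to a nonzero
  constant at the place.
\<close>

lemma place_poly_zero:
  assumes v: "place K v" and "0 < v (a - \<alpha>)" and "\<alpha> \<in> K" and "p \<in> polys" "p \<noteq> 0"
  shows "poly p a \<noteq> 0 \<and> v (poly p a) = int (order \<alpha> p) * v (a - \<alpha>)"
  using assms(4,5)
proof (induction "degree p" arbitrary: p rule: less_induct)
  case less
  have a: "a - \<alpha> \<noteq> 0"
    using assms(2) place_zero[OF v] by auto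
  have va: "0 \<le> v a"
    using place_nonneg_add[OF v, of "a - \<alpha>" \<alpha>] assms place_const[OF v] by simp
  define s where "s = synthetic_div p \<alpha>"
  have s: "s \<in> polys"
    unfolding s_def using less assms by (intro polys_synthetic_div) auto
  have p: "p = [:- \<alpha>, 1:] * s + [:poly p \<alpha>:]"
    unfolding s_def by (rule synthetic_div_correct'[symmetric])
  have pa: "poly p a = poly p \<alpha> + (a - \<alpha>) * poly s a"
    by (subst p) (simp add: algebra_simps)
  show ?case
  proof (cases "poly p \<alpha> = 0")
    case False
    have "0 \<le> v (poly s a)"
      using place_poly_nonneg[OF v va s] .
    then have "(a - \<alpha>) * poly s a = 0 \<or> v (poly p \<alpha>) < v ((a - \<alpha>) * poly s a)"
      using a assms place_const[OF v polys_value[OF less(2) assms(3)]]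
      by (cases "poly s a = 0") (auto simp: place_mult[OF v])
    from place_add_less[OF v False this] show ?thesis
      using False order_root[of p \<alpha>] place_const[OF v polys_value[OF less(2) assms(3)]]
      by (auto simp: pa)
  next
    case True
    then have p': "p = [:- \<alpha>, 1:] * s"
      using p by simp
    have s0: "s \<noteq> 0"
      using less p' by auto
    then have "degree p = Suc (degree s)"
      unfolding p' by (subst degree_mult_eq) auto
    then have IH: "poly s a \<noteq> 0" "v (poly s a) = int (order \<alpha> s) * v (a - \<alpha>)"
      using less(1)[OF _ s s0] by auto
    have "order \<alpha> p = order \<alpha> [:- \<alpha>, 1:] + order \<alpha> s"
      unfolding p' using less p' by (intro order_mult) auto
    also have "order \<alpha> [:- \<alpha>, 1:] = 1"
      using order_power_n_n[of \<alpha> 1] by simp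
    finally show ?thesis
      using True IH a by (simp add: pa place_mult[OF v] distrib_right)
  qed
qed

end

section \<open>The coordinate ring and its normal forms\<close>

locale curve = constant_field K for K :: "'a::field set" +
  fixes q n M :: nat and x y z :: 'a
  assumes primepow_q: "primepow q" and n_pos: "0 < n" and M_pos: "0 < M"
    and coprime_q_M: "coprime q M"
    and card_K: "card K = q ^ (2 * n)"
    and generated: "is_subfield hull (K \<union> {x, y, z}) = UNIV"
    and eq_xy: "x ^ q + x = y ^ (q + 1)"
    and eq_yz: "y ^ (q\<^sup>2) - y = z ^ M"
begin

lemma q_gt_1: "1 < q"
  using primepow_gt_Suc_0[OF primepow_q] by simp

lemma finite_K: "finite K"
  using card_K q_gt_1 by (metis card.infinite not_one_less_zero power_eq_0_iff)

lemma card_K_gt_1: "1 < card K"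
  unfolding card_K using n_pos by (intro one_less_power q_gt_1) simp

lemma q_CHAR: "prime CHAR('a)" "\<exists>e. q = CHAR('a) ^ e"
proof -
  \<comment> \<open>Translation by \<open>1\<close> permutes \<open>K\<close>, so comparing sums shows that \<open>card K\<close> is zero in the field.\<close>
  have "(\<Sum>a\<in>K. a + 1) = (\<Sum>a\<in>K. a)"
    by (rule sum.reindex_bij_witness[of _ "\<lambda>a. a - 1" "\<lambda>a. a + 1"]) (auto intro: K_add K_diff K_1)
  then have "of_nat (card K) = (0 :: 'a)"
    by (simp add: sum.distrib)
  then have dvd: "CHAR('a) dvd q ^ (2 * n)"
    unfolding card_K of_nat_eq_0_iff_char_dvd .
  then have "CHAR('a) \<noteq> 0"
    using q_gt_1 by (intro notI) simp
  then show p: "prime CHAR('a)"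
    by (simp add: prime_CHAR_semidom)
  with dvd have "CHAR('a) dvd q"
    using prime_dvd_power by blast
  moreover obtain p e where "prime p" "q = p ^ e"
    using primepow_q by (auto simp: primepow_def)
  ultimately have "CHAR('a) = p"
    using p by (metis prime_dvd_power primes_dvd_imp_eq)
  then show "\<exists>e. q = CHAR('a) ^ e"
    using \<open>q = p ^ e\<close> by auto
qed

lemma frobenius_add: "(a + b :: 'a) ^ (q ^ i) = a ^ (q ^ i) + b ^ (q ^ i)"
proof -
  obtain e where "q = CHAR('a) ^ e"
    using q_CHAR by auto
  then have *: "q ^ i = CHAR('a) ^ (e * i)"
    by (simp add: power_mult)
  show ?thesis
    using q_CHAR(1) * by (rule freshmans_dream')
qed

lemma frobenius_diff: "(a - b :: 'a) ^ (q ^ i) = a ^ (q ^ i) - b ^ (q ^ i)"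
  using frobenius_add[of "a - b" b i] by (simp add: algebra_simps)

lemma frobenius_K: "c \<in> K \<Longrightarrow> c ^ card K = c"
proof (cases "c = 0")
  case False
  assume c: "c \<in> K"
  let ?U = "K - {0}"
  have "(\<Prod>a\<in>?U. c * a) = (\<Prod>a\<in>?U. a)"
  proof (rule prod.reindex_bij_witness[of _ "\<lambda>a. a / c" "\<lambda>a. c * a"])
    fix a assume "a \<in> ?U"
    with c False show "a / c \<in> ?U"
      by (auto intro: K_divide)
  qed (use c False in \<open>auto intro: K_mult\<close>)
  moreover have "(\<Prod>a\<in>?U. a) \<noteq> 0"
    using finite_K by (simp add: prod_zero_iff)
  ultimately have "c ^ card ?U = 1"
    by (simp add: prod.distrib)
  moreover have "card K = Suc (card ?U)"
    by (rule card.remove[OF finite_K K_0])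
  ultimately show ?thesis
    by simp
qed (use card_K_gt_1 in \<open>simp add: power_0_left\<close>)

text \<open>
  The ring \<open>K[x, y, z]\<close>. Only multiplication by the three generators is built in, so that
  induction has to treat nothing but these; closure under products is a consequence.
\<close>

inductive_set A :: "'a set" where
  A_const: "c \<in> K \<Longrightarrow> c \<in> A"
| A_add: "a \<in> A \<Longrightarrow> b \<in> A \<Longrightarrow> a + b \<in> A"
| A_x: "a \<in> A \<Longrightarrow> x * a \<in> A"
| A_y: "a \<in> A \<Longrightarrow> y * a \<in> A"
| A_z: "a \<in> A \<Longrightarrow> z * a \<in> A"

lemma A_0: "0 \<in> A" and A_1: "1 \<in> A"
  using K_0 K_1 by (auto intro: A_const)

lemma A_xyz: "x \<in> A" "y \<in> A" "z \<in> A"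
  using A_x[OF A_1] A_y[OF A_1] A_z[OF A_1] by simp_all

lemma A_scale: "b \<in> A \<Longrightarrow> c \<in> K \<Longrightarrow> c * b \<in> A"
proof (induction rule: A.induct)
  case (A_x b)
  then show ?case using A.A_x[of "c * b"] by (simp add: algebra_simps)
next
  case (A_y b)
  then show ?case using A.A_y[of "c * b"] by (simp add: algebra_simps)
next
  case (A_z b)
  then show ?case using A.A_z[of "c * b"] by (simp add: algebra_simps)
qed (auto simp: distrib_left intro: A.intros K_mult)

lemma A_mult: "a \<in> A \<Longrightarrow> b \<in> A \<Longrightarrow> a * b \<in> A"
  by (induction rule: A.induct)
    (auto simp: distrib_right mult.assoc intro: A_scale A_add A_x A_y A_z)

lemma A_uminus: "a \<in> A \<Longrightarrow> - a \<in> A"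
  using A_scale[of a "- 1"] K_uminus[OF K_1] by simp

lemma A_diff: "a \<in> A \<Longrightarrow> b \<in> A \<Longrightarrow> a - b \<in> A"
  using A_add[of a "- b"] A_uminus[of b] by simp

lemma A_power: "a \<in> A \<Longrightarrow> a ^ i \<in> A"
  by (induction i) (auto intro: A_1 A_mult)

lemma A_poly: "a \<in> A \<Longrightarrow> p \<in> polys \<Longrightarrow> poly p a \<in> A"
  by (induction p) (auto simp: polys_pCons intro!: A_0 A_add A_mult intro: A_const)

lemma fraction:
  obtains a b where "a \<in> A" "b \<in> A" "b \<noteq> 0" "f = a / b"
proof -
  let ?F = "{a / b | a b. a \<in> A \<and> b \<in> A \<and> b \<noteq> 0}"
  have sub: "A \<subseteq> ?F"
    using A_1 by (force intro: exI[of _ 1])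
  have "is_subfield ?F"
    unfolding is_subfield_def
  proof (intro conjI ballI)
    show "0 \<in> ?F" "1 \<in> ?F"
      using A_0 A_1 sub by blast+
    fix f g assume "f \<in> ?F" "g \<in> ?F"
    then obtain a b c d where *: "a \<in> A" "b \<in> A" "c \<in> A" "d \<in> A" "b \<noteq> 0" "d \<noteq> 0"
        "f = a / b" "g = c / d"
      by auto
    have "f - g = (a * d - c * b) / (b * d)" "f * g = (a * c) / (b * d)"
      using * by (auto simp: field_simps)
    moreover have "a * d - c * b \<in> A" "a * c \<in> A" "b * d \<in> A" "b * d \<noteq> 0"
      using * by (auto intro: A_mult A_diff)
    ultimately show "f - g \<in> ?F" "f * g \<in> ?F"
      by blast+
  next
    fix f assume "f \<in> ?F"
    then obtain a b where *: "a \<in> A" "b \<in> A" "b \<noteq> 0" "f = a / b"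
      by auto
    show "inverse f \<in> ?F"
    proof (cases "a = 0")
      case True
      then show ?thesis
        using A_0 sub * by auto
    next
      case False
      have "inverse f = b / a"
        using * by simp
      with False * show ?thesis
        by blast
    qed
  qed
  moreover have "K \<union> {x, y, z} \<subseteq> ?F"
    using sub A_const A_xyz by auto
  ultimately have "is_subfield hull (K \<union> {x, y, z}) \<subseteq> ?F"
    by (intro hull_minimal)
  then have "f \<in> ?F"
    using generated by blast
  then show thesis
    using that by blast
qed

text \<open>
  The span of the monomials with \<open>z\<close>-exponent below \<open>M\<close> and \<open>y\<close>-exponent at most \<open>q\<close>. Higher
  powers are eliminated by the equations of the curve, first those of \<open>z\<close> at the cost of higher
  powers of \<open>y\<close>, then those of \<open>y\<close> at the cost of higher powers of \<open>x\<close>.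
\<close>

inductive_set N :: "'a set" where
  N_0: "0 \<in> N"
| N_step: "c \<in> K \<Longrightarrow> i < M \<Longrightarrow> j \<le> q \<Longrightarrow> a \<in> N \<Longrightarrow> c * (z ^ i * y ^ j * x ^ k) + a \<in> N"

lemma N_add: "a \<in> N \<Longrightarrow> b \<in> N \<Longrightarrow> a + b \<in> N"
  by (induction rule: N.induct) (auto simp: add.assoc intro: N_step)

lemma N_scale: "a \<in> N \<Longrightarrow> c \<in> K \<Longrightarrow> c * a \<in> N"
proof (induction rule: N.induct)
  case (N_step d i j a k)
  then have "(c * d) * (z ^ i * y ^ j * x ^ k) + c * a \<in> N"
    by (intro N.N_step K_mult)
  then show ?case
    by (simp add: algebra_simps)
qed (auto intro: N_0)

lemma N_monomial: "z ^ i * y ^ j * x ^ k \<in> N"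
proof -
  have 1: "z ^ i * y ^ j * x ^ k \<in> N" if "i < M" for i j k
  proof (induction j arbitrary: k rule: less_induct)
    case (less j)
    show ?case
    proof (cases "j \<le> q")
      case True
      from N_step[OF K_1 that True N_0] show ?thesis
        by simp
    next
      case False
      then obtain l where j: "j = l + (q + 1)"
        by (metis add.commute le_Suc_ex not_less_eq_eq Suc_eq_plus1)
      have "z ^ i * y ^ j * x ^ k = z ^ i * y ^ l * (x ^ q + x) * x ^ k"
        unfolding j power_add[of y l "q + 1"] eq_xy by simp
      also have "\<dots> = z ^ i * y ^ l * x ^ (k + q) + z ^ i * y ^ l * x ^ (k + 1)"
        by (simp add: algebra_simps power_add)
      also have "\<dots> \<in> N"
        using j by (intro N_add less.IH) auto
      finally show ?thesis .
    qed
  qed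
  show ?thesis
  proof (induction i arbitrary: j k rule: less_induct)
    case (less i)
    show ?case
    proof (cases "i < M")
      case False
      then obtain l where i: "i = l + M"
        by (metis add.commute le_Suc_ex not_less)
      have "z ^ i * y ^ j * x ^ k = z ^ l * (y ^ q\<^sup>2 - y) * y ^ j * x ^ k"
        unfolding i power_add eq_yz ..
      also have "\<dots> = z ^ l * y ^ (j + q\<^sup>2) * x ^ k + (- 1) * (z ^ l * y ^ (j + 1) * x ^ k)"
        by (simp add: algebra_simps power_add)
      also have "\<dots> \<in> N"
        using i M_pos by (intro N_add N_scale less.IH K_uminus K_1) auto
      finally show ?thesis .
    qed (rule 1)
  qed
qed

lemma A_subset_N:
  assumes "a \<in> A"
  shows "a \<in> N"
proof -
  have "z ^ i * y ^ j * x ^ k * a \<in> N" for i j k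
    using assms
  proof (induction arbitrary: i j k rule: A.induct)
    case (A_const c)
    then show ?case
      using N_scale[OF N_monomial] by (simp add: mult.commute)
  next
    case (A_add a b)
    then show ?case
      by (simp add: distrib_left N_add)
  next
    case (A_x a)
    from A_x.IH[of i j "k + 1"] show ?case by (simp add: ac_simps)
  next
    case (A_y a)
    from A_y.IH[of i "j + 1" k] show ?case by (simp add: ac_simps)
  next
    case (A_z a)
    from A_z.IH[of "i + 1" j k] show ?case by (simp add: ac_simps)
  qed
  from this[of 0 0 0] show ?thesis
    by simp
qed

definition exponents :: "(nat \<times> nat) set" where
  "exponents = {..<M} \<times> {..q}"

definition trm :: "nat \<times> nat \<Rightarrow> 'a poly \<Rightarrow> 'a" where
  "trm ij p = z ^ fst ij * y ^ snd ij * poly p x"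

lemma finite_exponents: "finite exponents"
  by (simp add: exponents_def)

lemma normal_form:
  assumes "a \<in> A"
  obtains p where "\<And>ij. p ij \<in> polys" "a = (\<Sum>ij\<in>exponents. trm ij (p ij))"
proof -
  from A_subset_N[OF assms]
  have "\<exists>p. (\<forall>ij. p ij \<in> polys) \<and> a = (\<Sum>ij\<in>exponents. trm ij (p ij))"
  proof (induction rule: N.induct)
    case N_0
    show ?case
      by (rule exI[of _ "\<lambda>_. 0"]) (simp add: trm_def polys_0)
  next
    case (N_step c i j a k)
    then obtain p where p: "\<And>ij. p ij \<in> polys" "a = (\<Sum>ij\<in>exponents. trm ij (p ij))"
      by auto
    define p' where "p' = p((i, j) := monom c k + p (i, j))"
    have "(i, j) \<in> exponents"
      using N_step by (simp add: exponents_def)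
    then have "(\<Sum>ij\<in>exponents. trm ij (p' ij)) =
        trm (i, j) (p' (i, j)) + (\<Sum>ij\<in>exponents - {(i, j)}. trm ij (p' ij))"
      by (simp add: sum.remove finite_exponents)
    also have "(\<Sum>ij\<in>exponents - {(i, j)}. trm ij (p' ij)) = (\<Sum>ij\<in>exponents - {(i, j)}. trm ij (p ij))"
      by (rule sum.cong) (auto simp: p'_def)
    also have "trm (i, j) (p' (i, j)) = c * (z ^ i * y ^ j * x ^ k) + trm (i, j) (p (i, j))"
      by (simp add: trm_def p'_def poly_monom algebra_simps)
    also have "\<dots> + (\<Sum>ij\<in>exponents - {(i, j)}. trm ij (p ij)) = c * (z ^ i * y ^ j * x ^ k) + a"
      using \<open>(i, j) \<in> exponents\<close> by (simp add: sum.remove[of exponents "(i, j)"] finite_exponents p(2))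
    finally have "c * (z ^ i * y ^ j * x ^ k) + a = (\<Sum>ij\<in>exponents. trm ij (p' ij))"
      by simp
    moreover have "p' ij \<in> polys" for ij
      using p(1) N_step by (auto simp: p'_def intro: polys_add polys_monom)
    ultimately show ?case
      by blast
  qed
  then show thesis
    using that by blast
qed

text \<open>
  If a place takes values on the terms \<open>z\<^bsup>i\<^esup> y\<^bsup>j\<^esup> p(x)\<close> that determine \<open>(i, j)\<close>, then no
  cancellation is possible in a normal form, and the place is known on the whole function field.
  Because the value group is \<open>\<int>\<close>, a common factor \<open>t\<close> of these values must be \<open>1\<close>.
\<close>

definition separated :: "(nat \<times> nat \<Rightarrow> 'a poly \<Rightarrow> int) \<Rightarrow> bool" where
  "separated w \<longleftrightarrow> (\<forall>ij\<in>exponents. \<forall>kl\<in>exponents. \<forall>p\<in>polys - {0}. \<forall>r\<in>polys - {0}. w ij p = w kl r \<longrightarrow> ij = kl)"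

definition has_weights :: "('a \<Rightarrow> int) \<Rightarrow> int \<Rightarrow> (nat \<times> nat \<Rightarrow> 'a poly \<Rightarrow> int) \<Rightarrow> bool" where
  "has_weights v t w \<longleftrightarrow> place K v \<and> 0 < t \<and> separated w \<and>
     (\<forall>ij\<in>exponents. \<forall>p\<in>polys - {0}. trm ij p \<noteq> 0 \<and> v (trm ij p) = t * w ij p)"

lemma has_weights_normal_form:
  assumes w: "has_weights v t w" and p: "\<And>ij. p ij \<in> polys"
    and a: "a = (\<Sum>ij\<in>exponents. trm ij (p ij))" "a \<noteq> 0"
  shows "\<exists>ij\<in>exponents. p ij \<noteq> 0 \<and> v a = t * w ij (p ij) \<and>
    (\<forall>kl\<in>exponents. p kl \<noteq> 0 \<longrightarrow> w ij (p ij) \<le> w kl (p kl))"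
proof -
  define I where "I = {ij \<in> exponents. p ij \<noteq> 0}"
  have v: "place K v" and t: "0 < t"
    and val: "\<And>ij. ij \<in> I \<Longrightarrow> trm ij (p ij) \<noteq> 0 \<and> v (trm ij (p ij)) = t * w ij (p ij)"
    using w p by (auto simp: has_weights_def I_def)
  have aI: "a = (\<Sum>ij\<in>I. trm ij (p ij))"
    unfolding a(1) I_def using finite_exponents
    by (intro sum.mono_neutral_right) (auto simp: trm_def)
  have "I \<noteq> {}"
    using aI a(2) by auto
  moreover have "finite I"
    using finite_exponents by (simp add: I_def)
  moreover have "inj_on (\<lambda>ij. v (trm ij (p ij))) I"
  proof (rule inj_onI)
    fix ij kl assume *: "ij \<in> I" "kl \<in> I" "v (trm ij (p ij)) = v (trm kl (p kl))"
    then have "w ij (p ij) = w kl (p kl)"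
      using val t by simp
    then show "ij = kl"
      using w * p unfolding has_weights_def separated_def I_def by blast
  qed
  ultimately have "\<exists>ij\<in>I. v a = v (trm ij (p ij)) \<and>
      (\<forall>kl\<in>I. v (trm ij (p ij)) \<le> v (trm kl (p kl)))"
    unfolding aI using val by (intro place_sum_distinct(2)[OF v]) auto
  then obtain ij where ij: "ij \<in> I" "v a = v (trm ij (p ij))"
      "\<forall>kl\<in>I. v (trm ij (p ij)) \<le> v (trm kl (p kl))"
    by blast
  have "w ij (p ij) \<le> w kl (p kl)" if "kl \<in> I" for kl
    using ij that val t by simp
  then show ?thesis
    using ij val by (intro bexI[of _ ij]) (auto simp: I_def)
qed

text \<open>All values on \<open>A\<close>, hence on its fraction field, are multiples of \<open>t\<close>.\<close>

lemma has_weights_normalized: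
  assumes w: "has_weights v t w"
  shows "t = 1"
proof -
  have v: "place K v" and t: "0 < t"
    using w by (auto simp: has_weights_def)
  obtain f where f: "f \<noteq> 0" "v f = 1"
    using v by (auto simp: place_def)
  obtain a b where ab: "a \<in> A" "b \<in> A" "b \<noteq> 0" "f = a / b"
    by (rule fraction)
  have dvd: "t dvd v a" if a: "a \<in> A" "a \<noteq> 0" for a
  proof -
    obtain p where p: "\<And>ij. p ij \<in> polys" "a = (\<Sum>ij\<in>exponents. trm ij (p ij))"
        using normal_form[OF a(1)] by blast
    from has_weights_normal_form[OF w p a(2)] show ?thesis
      by auto
  qed
  have "a \<noteq> 0"
    using f ab by auto
  then have "v f = v a - v b"
    using ab by (simp add: place_divide[OF v])
  then have "t dvd 1"
    using dvd ab \<open>a \<noteq> 0\<close> f by (metis dvd_diff)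
  then show ?thesis
    using t by simp
qed

lemma has_weights_unique:
  assumes w: "has_weights v t w" and w': "has_weights v' t' w"
  shows "v = v'"
proof
  fix f
  have t: "t = 1" "t' = 1"
    using assms has_weights_normalized by auto
  have v: "place K v" "place K v'"
    using assms by (auto simp: has_weights_def)
  have eq: "v a = v' a" if a: "a \<in> A" for a
  proof (cases "a = 0")
    case False
    obtain p where p: "\<And>ij. p ij \<in> polys" "a = (\<Sum>ij\<in>exponents. trm ij (p ij))"
        using normal_form[OF a(1)] by blast
    obtain ij where ij: "ij \<in> exponents" "p ij \<noteq> 0" "v a = w ij (p ij)"
        "\<And>kl. kl \<in> exponents \<Longrightarrow> p kl \<noteq> 0 \<Longrightarrow> w ij (p ij) \<le> w kl (p kl)"
      using has_weights_normal_form[OF w p False] t by auto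
    obtain kl where kl: "kl \<in> exponents" "p kl \<noteq> 0" "v' a = w kl (p kl)"
        "\<And>ij. ij \<in> exponents \<Longrightarrow> p ij \<noteq> 0 \<Longrightarrow> w kl (p kl) \<le> w ij (p ij)"
      using has_weights_normal_form[OF w' p False] t by auto
    show ?thesis
      using ij(4)[OF kl(1,2)] kl(4)[OF ij(1,2)] ij(3) kl(3) by simp
  qed (simp add: place_zero[OF v(1)] place_zero[OF v(2)])
  obtain a b where ab: "a \<in> A" "b \<in> A" "b \<noteq> 0" "f = a / b"
    by (rule fraction)
  then show "v f = v' f"
    using eq v by (cases "a = 0") (auto simp: place_divide place_zero)
qed


section \<open>The places at infinity and at the points \<open>(\<alpha>, 0, 0)\<close>\<close>

lemma int_coprime_q_M: "coprime (int q) (int M)" and int_coprime_q_Suc: "coprime (int q) (int q + 1)"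
  using coprime_q_M by simp_all

text \<open>Reduction modulo \<open>M\<close> recovers \<open>i\<close>, and then reduction modulo \<open>q + 1\<close> recovers \<open>j\<close>.\<close>

lemma separation:
  assumes "i < M" "i' < M" "j \<le> q" "j' \<le> q"
    and "coprime c (int M)" and "coprime e (int q + 1)"
    and eq: "int i * c + int j * e * int M + (int q + 1) * int M * d =
         int i' * c + int j' * e * int M + (int q + 1) * int M * d'"
  shows "i = i' \<and> j = j'"
proof -
  have small: "a = b" if "b < k" "a < k" "int k dvd int a - int b" for a b k :: nat
    using that by (metis mod_less of_nat_eq_iff mod_eq_dvd_iff zmod_int)
  have "(int i - int i') * c =
      int M * (int j' * e + (int q + 1) * d' - int j * e - (int q + 1) * d)"
    using eq by (simp add: algebra_simps)
  then have "int M dvd (int i - int i') * c"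
    by (metis dvd_triv_left)
  then have "int M dvd int i - int i'"
    using assms(5) by (simp add: coprime_commute coprime_dvd_mult_left_iff)
  then have i: "i = i'"
    using small assms by blast
  have "int M * ((int j - int j') * e) = int M * ((int q + 1) * (d' - d))"
    using eq i by (simp add: algebra_simps)
  then have "(int j - int j') * e = (int q + 1) * (d' - d)"
    using M_pos by (metis mult_cancel_left of_nat_eq_0_iff less_irrefl)
  then have "int q + 1 dvd (int j - int j') * e"
    by simp
  then have "int (q + 1) dvd int j - int j'"
    using assms(6) by (simp add: coprime_commute coprime_dvd_mult_left_iff add.commute)
  then have "j = j'"
    using small[of j' "q + 1" j] assms by simp
  with i show ?thesis ..
qed

definition wt_inf :: "nat \<times> nat \<Rightarrow> int \<Rightarrow> int" where
  "wt_inf ij d = - (int (fst ij) * int q ^ 3 + int (snd ij) * int q * int M + (int q + 1) * int M * d)"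

definition wt_zero :: "nat \<times> nat \<Rightarrow> int \<Rightarrow> int" where
  "wt_zero ij d = int (fst ij) + int (snd ij) * int M + (int q + 1) * int M * d"

lemma wt_inf_separates: "ij \<in> exponents \<Longrightarrow> kl \<in> exponents \<Longrightarrow> wt_inf ij d = wt_inf kl d' \<Longrightarrow> ij = kl"
  using separation[of "fst ij" "fst kl" "snd ij" "snd kl" "int q ^ 3" "int q" d d']
    int_coprime_q_M int_coprime_q_Suc
  by (auto simp: wt_inf_def exponents_def prod_eq_iff)

lemma wt_zero_separates: "ij \<in> exponents \<Longrightarrow> kl \<in> exponents \<Longrightarrow> wt_zero ij d = wt_zero kl d' \<Longrightarrow> ij = kl"
  using separation[of "fst ij" "fst kl" "snd ij" "snd kl" 1 1 d d']
  by (auto simp: wt_zero_def exponents_def prod_eq_iff)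

lemma power_sum_pole:
  assumes v: "place K v" and "v a < 0" and "1 < k"
  shows "a ^ k + a \<noteq> 0" "v (a ^ k + a) = int k * v a"
    and "a ^ k - a \<noteq> 0" "v (a ^ k - a) = int k * v a"
proof -
  have a: "a \<noteq> 0"
    using assms place_zero by fastforce
  have "int k * v a < 1 * v a"
    using assms by (intro mult_strict_right_mono_neg) auto
  then have *: "v (a ^ k) < v a" "v (a ^ k) < v (- a)"
    using a by (simp_all add: place_power[OF v] place_uminus[OF v])
  have 1: "b = 0 \<or> v (a ^ k) < v b" if "b = a \<or> b = - a" for b
    using * that by auto
  note 2 = place_add_less[OF v, of "a ^ k"] place_power[OF v a, of k]
  show "a ^ k + a \<noteq> 0" "v (a ^ k + a) = int k * v a"
    using 2 1[of a] a by auto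
  show "a ^ k - a \<noteq> 0" "v (a ^ k - a) = int k * v a"
    using 2(1,2)[of "- a"] 2(3) 1[of "- a"] a by auto
qed

text \<open>
  Comparing pole orders in the two equations gives \<open>q v(x) = (q + 1) v(y)\<close> and \<open>q\<^sup>2 v(y) = M
  v(z)\<close>; by coprimality the three values have a common parameter \<open>u\<close>.
\<close>

lemma weights_at_infinity:
  assumes v: "place K v" and "v x < 0"
  shows "\<exists>t. has_weights v t (\<lambda>ij p. wt_inf ij (int (degree p)))"
proof -
  have ne: "x \<noteq> 0" "y \<noteq> 0" and vxy: "int q * v x = (int q + 1) * v y"
    using power_sum_pole(1,2)[OF v assms(2) q_gt_1] assms place_zero[OF v] place_power[OF v, of y "q + 1"]
    by (auto simp: eq_xy)
  have vy: "v y < 0"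
  proof (rule ccontr)
    assume "\<not> v y < 0"
    then have "0 \<le> (int q + 1) * v y"
      by simp
    moreover have "int q * v x < 0"
      using q_gt_1 assms(2) by (intro mult_pos_neg) auto
    ultimately show False
      using vxy by simp
  qed
  have "1 < q\<^sup>2"
    by (intro one_less_power q_gt_1) simp
  from power_sum_pole(3,4)[OF v vy this]
  have z: "z \<noteq> 0" and vyz: "int q ^ 2 * v y = int M * v z"
    using M_pos place_power[OF v, of z M] by (auto simp: eq_yz power_0_left)
  have "int q dvd v y"
    using vxy int_coprime_q_Suc by (metis dvd_triv_left coprime_dvd_mult_right_iff)
  then obtain w where w: "v y = int q * w"
    by auto
  have "int M dvd int q ^ 3 * w"
    using vyz w by (metis dvd_triv_left mult.assoc power2_eq_square power3_eq_cube)
  then have "int M dvd w"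
    using int_coprime_q_M by (simp add: coprime_commute coprime_dvd_mult_right_iff)
  then obtain u where u: "w = int M * u"
    by auto
  have "int M * v z = int M * (int q ^ 3 * u)"
    using vyz unfolding w u power2_eq_square power3_eq_cube by (simp only: ac_simps)
  then have vz: "v z = int q ^ 3 * u"
    using M_pos by simp
  have "int q * v x = int q * ((int q + 1) * int M * u)"
    using vxy w u by (simp only: ac_simps)
  then have vx: "v x = (int q + 1) * int M * u"
    using q_gt_1 by (metis mult_cancel_left of_nat_eq_0_iff not_one_less_zero)
  have "u < 0"
    using vy w u q_gt_1 M_pos by (auto simp: mult_less_0_iff)
  have "has_weights v (- u) (\<lambda>ij p. wt_inf ij (int (degree p)))"
    unfolding has_weights_def separated_def
  proof (intro conjI ballI impI)
    fix ij p assume "ij \<in> exponents" "p \<in> polys - {0}"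
    then have p: "poly p x \<noteq> 0" "v (poly p x) = int (degree p) * v x"
      using place_poly_pole[OF v assms(2), of p] by auto
    show "trm ij p \<noteq> 0"
      using p z ne by (simp add: trm_def)
    have "v (trm ij p) = int (fst ij) * v z + int (snd ij) * v y + int (degree p) * v x"
      using p z ne by (simp add: trm_def place_mult[OF v] place_power[OF v])
    also have "\<dots> = - u * wt_inf ij (int (degree p))"
      by (simp add: vx vz w u wt_inf_def algebra_simps)
    finally show "v (trm ij p) = - u * wt_inf ij (int (degree p))" .
  qed (use v \<open>u < 0\<close> wt_inf_separates in auto)
  then show ?thesis ..
qed

text \<open>
  With \<open>d = x - \<alpha>\<close> the first equation reads \<open>d\<^bsup>q\<^esup> + d = y\<^bsup>q + 1\<^esup>\<close> by the additivity of Frobenius.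
  In both equations the linear term dominates at a zero, so \<open>v(d) = (q + 1) v(y)\<close> and \<open>v(y) = M
  v(z)\<close>.
\<close>

lemma weights_at_zero:
  assumes v: "place K v" and "0 < v (x - \<alpha>)" and \<alpha>: "\<alpha> \<in> K" "\<alpha> ^ q + \<alpha> = 0"
  shows "\<exists>t. has_weights v t (\<lambda>ij p. wt_zero ij (int (order \<alpha> p)))"
proof -
  let ?d = "x - \<alpha>"
  have d: "?d \<noteq> 0"
    using assms(2) place_zero[OF v] by auto
  have "y ^ (q + 1) = ?d ^ q + ?d"
    using \<alpha>(2) frobenius_diff[of x \<alpha> 1] eq_xy[symmetric]
    by (simp add: algebra_simps add_eq_0_iff)
  then have "y ^ (q + 1) = ?d + ?d ^ q"
    by simp
  moreover have "v ?d < v (?d ^ q)"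
    using assms q_gt_1 d by (simp add: place_power[OF v])
  ultimately have "y ^ (q + 1) \<noteq> 0" and "v (y ^ (q + 1)) = v ?d"
    using place_add_less[OF v d, of "?d ^ q"] by auto
  then have y: "y \<noteq> 0" and vy: "(int q + 1) * v y = v ?d"
    using place_power[OF v, of y "q + 1"] by (auto simp: algebra_simps)
  then have "0 < v y"
    using assms(2) zero_less_mult_pos[of "int q + 1" "v y"] by simp
  have "1 < q\<^sup>2"
    by (intro one_less_power q_gt_1) simp
  moreover have "1 < int q ^ 2"
    using q_gt_1 by (intro one_less_power) auto
  ultimately have "v (- y) < v (y ^ q\<^sup>2)"
    using \<open>0 < v y\<close> y by (simp add: place_power[OF v] place_uminus[OF v])
  then have "- y + y ^ q\<^sup>2 \<noteq> 0" and "v (- y + y ^ q\<^sup>2) = v y"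
    using place_add_less[OF v, of "- y" "y ^ q\<^sup>2"] y place_uminus[OF v, of y] by auto
  moreover have "- y + y ^ q\<^sup>2 = z ^ M"
    using eq_yz by simp
  ultimately have zM: "z ^ M \<noteq> 0" and vzM: "v (z ^ M) = v y"
    by metis+
  then have z: "z \<noteq> 0"
    using M_pos by (auto simp: power_0_left)
  then have vz: "int M * v z = v y"
    using vzM place_power[OF v z, of M] by simp
  have "0 < v z"
    using \<open>0 < v y\<close> vz zero_less_mult_pos[of "int M" "v z"] M_pos by simp
  have "has_weights v (v z) (\<lambda>ij p. wt_zero ij (int (order \<alpha> p)))"
    unfolding has_weights_def separated_def
  proof (intro conjI ballI impI)
    fix ij p assume "ij \<in> exponents" "p \<in> polys - {0}"
    then have p: "poly p x \<noteq> 0" "v (poly p x) = int (order \<alpha> p) * v ?d"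
      using place_poly_zero[OF v assms(2) \<alpha>(1), of p] by auto
    show "trm ij p \<noteq> 0"
      using p z y by (simp add: trm_def)
    have "v (trm ij p) = int (fst ij) * v z + int (snd ij) * v y + int (order \<alpha> p) * v ?d"
      using p z y by (simp add: trm_def place_mult[OF v] place_power[OF v])
    also have "\<dots> = v z * wt_zero ij (int (order \<alpha> p))"
      by (simp add: vy[symmetric] vz[symmetric] wt_zero_def algebra_simps)
    finally show "v (trm ij p) = v z * wt_zero ij (int (order \<alpha> p))" .
  qed (use v \<open>0 < v z\<close> wt_zero_separates in auto)
  then show ?thesis ..
qed

text \<open>By the defining equations \<open>y\<close> is integral over \<open>K[x]\<close>, and \<open>z\<close> over \<open>K[y]\<close>.\<close>

lemma pole_iff:
  assumes v: "place K v"
  shows "v y < 0 \<Longrightarrow> v x < 0" and "v z < 0 \<Longrightarrow> v x < 0"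
proof -
  show x: "v x < 0" if "v y < 0"
  proof (rule ccontr)
    assume "\<not> v x < 0"
    then have "0 \<le> v (x ^ q + x)"
      by (intro place_nonneg_add[OF v] place_nonneg_power[OF v]) auto
    moreover have "v (x ^ q + x) = (int q + 1) * v y"
      unfolding eq_xy using that place_power[OF v, of y "q + 1"] place_zero[OF v] by force
    ultimately show False
      using that by (auto simp: zero_le_mult_iff)
  qed
  show "v x < 0" if "v z < 0"
  proof (rule ccontr)
    assume "\<not> v x < 0"
    then have vy: "0 \<le> v y"
      using x by force
    have "z \<noteq> 0"
      using that place_zero[OF v] by auto
    have "0 \<le> v (y ^ q\<^sup>2 + - y)"
      using vy by (intro place_nonneg_add[OF v] place_nonneg_power[OF v]) (auto simp: place_uminus[OF v])
    moreover have "v (y ^ q\<^sup>2 + - y) = int M * v z"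
      using place_power[OF v, of z M] \<open>z \<noteq> 0\<close> eq_yz by simp
    ultimately show False
      using that M_pos by (auto simp: zero_le_mult_iff)
  qed
qed

end

section \<open>Functions with poles only at infinity\<close>

context constant_field
begin

text \<open>
  The condition on coefficients includes \<open>0\<close> also for \<open>e = 0\<close>, where \<open>degree p < e\<close> would exclude
  it.
\<close>

definition polys_lt :: "nat \<Rightarrow> 'a poly set" where
  "polys_lt e = {p \<in> polys. \<forall>i\<ge>e. coeff p i = 0}"

lemma card_polys_lt: "finite K \<Longrightarrow> finite (polys_lt e) \<and> card (polys_lt e) = card K ^ e"
proof (induction e)
  case 0
  have "polys_lt 0 = {0}"
    by (auto simp: polys_lt_def polys_0 poly_eq_iff)
  then show ?case
    by simp
next
  case (Suc e)
  have "polys_lt (Suc e) = (\<lambda>(c, p). pCons c p) ` (K \<times> polys_lt e)"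
  proof (intro equalityI subsetI)
    fix p assume p: "p \<in> polys_lt (Suc e)"
    obtain c r where "p = pCons c r"
      by (cases p)
    with p have "c \<in> K" "r \<in> polys"
      by (auto simp: polys_lt_def polys_pCons)
    moreover have "coeff r i = 0" if "e \<le> i" for i
      using p that \<open>p = pCons c r\<close> by (auto simp: polys_lt_def dest!: spec[of _ "Suc i"])
    ultimately show "p \<in> (\<lambda>(c, p). pCons c p) ` (K \<times> polys_lt e)"
      using \<open>p = pCons c r\<close> by (force simp: polys_lt_def)
  qed (auto simp: polys_lt_def polys_pCons coeff_pCons split: nat.split)
  moreover have "inj_on (\<lambda>(c, p). pCons c p) (K \<times> polys_lt e)"
    by (auto simp: inj_on_def)
  ultimately show ?case
    using Suc by (simp add: card_image card_cartesian_product)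
qed

end

locale curve_at_infinity = curve K q n M x y z for K :: "'a::field set" and q n M and x y z :: 'a +
  fixes vinf :: "'a \<Rightarrow> int"
  assumes rational_inf: "rational_place K vinf"
    and pole_xz: "vinf x < 0" "vinf z < 0"
begin

lemma place_inf: "place K vinf"
  using rational_inf by (simp add: rational_place_def)

lemma weights_inf: "has_weights vinf 1 (\<lambda>ij p. wt_inf ij (int (degree p)))"
  using weights_at_infinity[OF place_inf pole_xz(1)] has_weights_normalized by auto

lemma place_inf_unique: "place K v \<Longrightarrow> v x < 0 \<Longrightarrow> v = vinf"
  using weights_at_infinity[of v] weights_inf has_weights_unique by blast

lemma wt_inf_nonpos: "0 \<le> d \<Longrightarrow> wt_inf ij d \<le> 0"
  unfolding wt_inf_def neg_le_0_iff_le by (intro add_nonneg_nonneg mult_nonneg_nonneg) auto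

lemma A_pole_inf:
  assumes "a \<in> A" "a \<noteq> 0"
  shows "vinf a \<le> 0"
proof -
  obtain p where p: "\<And>ij. p ij \<in> polys" "a = (\<Sum>ij\<in>exponents. trm ij (p ij))"
    using normal_form[OF assms(1)] by blast
  then show ?thesis
    using has_weights_normal_form[OF weights_inf p assms(2)] wt_inf_nonpos by auto
qed

lemma z_transcendental: "p \<in> polys \<Longrightarrow> p \<noteq> 0 \<Longrightarrow> poly p z \<noteq> 0"
  using place_poly_pole[OF place_inf pole_xz(2)] by blast

text \<open>
  Once \<open>A\<close> is identified with the functions regular outside infinity, this is the Riemann-Roch
  space of \<open>d\<close> times the place at infinity.
\<close>

definition L :: "int \<Rightarrow> 'a set" where
  "L d = {a \<in> A. a = 0 \<or> - d \<le> vinf a}"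

lemma L_negative: "d < 0 \<Longrightarrow> L d = {0}"
  using A_pole_inf A_0 by (fastforce simp: L_def)

text \<open>Since the residue field is \<open>K\<close>, allowing one more pole adds at most one dimension.\<close>

lemma L_step:
  assumes "finite (L (d - 1))"
  shows "finite (L d) \<and> card (L d) \<le> card K * card (L (d - 1))"
proof (cases "L d \<subseteq> L (d - 1)")
  case True
  then have "card (L d) \<le> card (L (d - 1))"
    using assms by (intro card_mono)
  moreover have "card (L (d - 1)) \<le> card K * card (L (d - 1))"
    using card_K_gt_1 by simp
  ultimately have "card (L d) \<le> card K * card (L (d - 1))"
    by (rule order_trans)
  then show ?thesis
    using True assms finite_subset by auto
next
  case False
  then obtain g where g: "g \<in> A" "g \<noteq> 0" "vinf g = - d"
    by (force simp: L_def)
  have "L d \<subseteq> (\<lambda>(c, b). c * g + b) ` (K \<times> L (d - 1))"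
  proof
    fix f assume f: "f \<in> L d"
    have "0 \<le> vinf (f / g)"
      using f g place_divide[OF place_inf, of f g] place_zero[OF place_inf]
      by (cases "f = 0") (auto simp: L_def)
    then obtain c where c: "c \<in> K" "f / g = c \<or> 0 < vinf (f / g - c)"
      using rational_inf by (auto simp: rational_place_def)
    have "f - c * g \<in> L (d - 1)"
    proof (cases "f = c * g")
      case True
      then show ?thesis
        by (simp add: L_def A_0)
    next
      case False
      then have ne: "f / g - c \<noteq> 0"
        using g by auto
      then have "vinf ((f / g - c) * g) = vinf (f / g - c) + vinf g"
        using g by (intro place_mult[OF place_inf])
      moreover have "(f / g - c) * g = f - c * g"
        using g by (simp add: field_simps)
      ultimately have "- (d - 1) \<le> vinf (f - c * g)"
        using c ne g by auto
      then show ?thesis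
        using f g c by (auto simp: L_def intro: A_diff A_scale)
    qed
    then show "f \<in> (\<lambda>(c, b). c * g + b) ` (K \<times> L (d - 1))"
      using c by (intro image_eqI[of _ _ "(c, f - c * g)"]) auto
  qed
  moreover have "finite ((\<lambda>(c, b). c * g + b) ` (K \<times> L (d - 1)))"
    using finite_K assms by simp
  moreover have "card ((\<lambda>(c, b). c * g + b) ` (K \<times> L (d - 1))) \<le> card K * card (L (d - 1))"
    by (rule order_trans[OF card_image_le]) (use finite_K assms in \<open>simp_all add: card_cartesian_product\<close>)
  ultimately show ?thesis
    by (meson card_mono finite_subset order_trans)
qed

lemma finite_L: "finite (L d)"
proof -
  have "finite (L (int k - 1))" for k
  proof (induction k)
    case (Suc k)
    then show ?case
      using L_step[of "int k"] by simp
  qed (simp add: L_negative)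
  from this[of "nat (d + 1)"] show ?thesis
    by (cases "d < 0") (simp_all add: L_negative)
qed

lemma card_L_growth: "card (L (d + int k)) \<le> card K ^ k * card (L d)"
proof (induction k)
  case (Suc k)
  have "card (L (d + int (Suc k))) \<le> card K * card (L (d + int k))"
    using L_step[OF finite_L, of "d + int (Suc k)"] by (simp add: algebra_simps)
  also have "\<dots> \<le> card K * (card K ^ k * card (L d))"
    using Suc by simp
  finally show ?case
    by simp
qed simp

text \<open>
  This is a count of dimensions: the ideal \<open>a A\<close> misses at most \<open>- vinf a\<close> dimensions of \<open>A\<close>, and
  the polynomials in \<open>z\<close> of bounded degree form a space of larger dimension.
\<close>

lemma multiple_in_polys:
  assumes a: "a \<in> A" "a \<noteq> 0"
  shows "\<exists>p\<in>polys. \<exists>b\<in>A. p \<noteq> 0 \<and> poly p z = a * b"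
proof -
  define d where "d = nat (- vinf a)"
  have d: "vinf a = - int d"
    using A_pole_inf[OF a] by (simp add: d_def)
  \<comment> \<open>More than the codimension of \<open>a A\<close>; \<open>D\<close> bounds the pole orders of polynomials of degree below \<open>e\<close>.\<close>
  define e where "e = Suc d"
  define D where "D = int e * (- vinf z)"
  define F where "F = (\<lambda>(p, b). poly p z + a * b)"
  have D: "0 \<le> D"
    using pole_xz by (simp add: D_def mult_nonneg_nonpos)
  have "F ` (polys_lt e \<times> L D) \<subseteq> L (D + int d)"
  proof (clarsimp simp: F_def)
    fix p b assume p: "p \<in> polys_lt e" and b: "b \<in> L D"
    have pp: "p \<in> polys"
      using p by (simp add: polys_lt_def)
    have "poly p z = 0 \<or> - (D + int d) \<le> vinf (poly p z)"
    proof (cases "p = 0")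
      case False
      have "degree p < e"
        using False p leading_coeff_0_iff[of p] by (auto simp: polys_lt_def simp flip: not_le)
      then have "int (degree p) * (- vinf z) \<le> D"
        unfolding D_def using pole_xz by (intro mult_right_mono) auto
      then show ?thesis
        using place_poly_pole[OF place_inf pole_xz(2) pp False] by simp
    qed simp
    moreover have "a * b = 0 \<or> - (D + int d) \<le> vinf (a * b)"
      using a b d by (cases "b = 0") (auto simp: L_def place_mult[OF place_inf])
    ultimately have "poly p z + a * b = 0 \<or> - (D + int d) \<le> vinf (poly p z + a * b)"
      by (rule place_add_ge[OF place_inf])
    moreover have "poly p z + a * b \<in> A"
      using a b pp by (auto simp: L_def intro!: A_add A_mult A_poly A_xyz)
    ultimately show "poly p z + a * b \<in> L (D + int d)"
      by (simp add: L_def)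
  qed
  then have "card (F ` (polys_lt e \<times> L D)) \<le> card (L (D + int d))"
    by (intro card_mono finite_L)
  also have "\<dots> \<le> card K ^ d * card (L D)"
    by (rule card_L_growth)
  also have "\<dots> < card K ^ e * card (L D)"
  proof -
    have "0 < card (L D)"
      using finite_L A_0 by (auto simp: card_gt_0_iff L_def)
    then show ?thesis
      unfolding e_def using card_K_gt_1 by simp
  qed
  also have "\<dots> = card (polys_lt e \<times> L D)"
    using card_polys_lt[OF finite_K] by (simp add: card_cartesian_product)
  finally have "\<not> inj_on F (polys_lt e \<times> L D)"
    using pigeonhole by blast
  then obtain p b p' b' where *: "p \<in> polys" "p' \<in> polys" "b \<in> A" "b' \<in> A" "(p, b) \<noteq> (p', b')"
      "poly p z + a * b = poly p' z + a * b'"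
    by (auto simp: inj_on_def F_def polys_lt_def L_def)
  have "p - p' \<noteq> 0"
    using * a by auto
  moreover have "poly (p - p') z = a * (b' - b)"
    using *(6) by (simp add: algebra_simps)
  ultimately show ?thesis
    using * by (intro bexI[of _ "p - p'"] bexI[of _ "b' - b"]) (auto intro: polys_diff A_diff)
qed

definition ideal :: "'a set \<Rightarrow> bool" where
  "ideal I \<longleftrightarrow> I \<subseteq> A \<and> 0 \<in> I \<and> (\<forall>a\<in>I. \<forall>b\<in>I. a + b \<in> I) \<and> (\<forall>a\<in>I. \<forall>b\<in>A. b * a \<in> I)"

definition prime_ideal :: "'a set \<Rightarrow> bool" where
  "prime_ideal P \<longleftrightarrow> ideal P \<and> 1 \<notin> P \<and> (\<forall>a\<in>A. \<forall>b\<in>A. a * b \<in> P \<longrightarrow> a \<in> P \<or> b \<in> P)"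

lemma ideal_add: "ideal I \<Longrightarrow> a \<in> I \<Longrightarrow> b \<in> I \<Longrightarrow> a + b \<in> I"
  and ideal_mult: "ideal I \<Longrightarrow> a \<in> I \<Longrightarrow> b \<in> A \<Longrightarrow> b * a \<in> I"
  and ideal_mult': "ideal I \<Longrightarrow> a \<in> I \<Longrightarrow> b \<in> A \<Longrightarrow> a * b \<in> I"
  and ideal_0: "ideal I \<Longrightarrow> 0 \<in> I" and ideal_subset: "ideal I \<Longrightarrow> a \<in> I \<Longrightarrow> a \<in> A"
  by (auto simp: ideal_def mult.commute)

lemma ideal_diff: "ideal I \<Longrightarrow> a \<in> I \<Longrightarrow> b \<in> I \<Longrightarrow> a - b \<in> I"
  using ideal_add[of I a "(- 1) * b"] ideal_mult[of I b "- 1"] A_uminus[OF A_1] by simp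

lemma ideal_sum: "ideal I \<Longrightarrow> (\<And>i. i \<in> S \<Longrightarrow> f i \<in> I) \<Longrightarrow> sum f S \<in> I"
  by (induction S rule: infinite_finite_induct) (auto simp: ideal_0 ideal_add)

lemma ideal_power: "ideal I \<Longrightarrow> a \<in> I \<Longrightarrow> 0 < k \<Longrightarrow> a ^ k \<in> I"
  by (induction k) (auto intro: ideal_mult' A_power ideal_subset)

text \<open>
  A maximal element among the proper ideals above \<open>I\<close> is prime, being comaximal to every element
  outside.
\<close>

lemma prime_ideal_exists:
  assumes I: "ideal I" "1 \<notin> I"
  shows "\<exists>P. prime_ideal P \<and> I \<subseteq> P"
proof -
  define S where "S = {J. ideal J \<and> 1 \<notin> J \<and> I \<subseteq> J}"
  have "\<exists>P\<in>S. \<forall>J\<in>S. P \<subseteq> J \<longrightarrow> J = P"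
  proof (rule subset_Zorn_nonempty)
    show "S \<noteq> {}"
      using I by (auto simp: S_def)
    fix C assume "C \<noteq> {}" "subset.chain S C"
    then have C: "\<And>J. J \<in> C \<Longrightarrow> ideal J \<and> 1 \<notin> J \<and> I \<subseteq> J"
      and chain: "\<And>J J'. J \<in> C \<Longrightarrow> J' \<in> C \<Longrightarrow> J \<subseteq> J' \<or> J' \<subseteq> J"
      by (auto simp: subset_chain_def S_def)
    have "ideal (\<Union>C)"
      unfolding ideal_def
    proof (intro conjI ballI)
      show "\<Union>C \<subseteq> A" "0 \<in> \<Union>C"
        using C \<open>C \<noteq> {}\<close> ideal_subset ideal_0 by blast+
      show "a + b \<in> \<Union>C" if ab: "a \<in> \<Union>C" "b \<in> \<Union>C" for a b
      proof -
        obtain J J' where J: "J \<in> C" "J' \<in> C" "a \<in> J" "b \<in> J'"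
          using ab by blast
        then have "\<exists>J\<in>C. a \<in> J \<and> b \<in> J"
          using chain by blast
        then show ?thesis
          using C ideal_add by blast
      qed
      show "b * a \<in> \<Union>C" if "a \<in> \<Union>C" "b \<in> A" for a b
        using that C ideal_mult by blast
    qed
    then show "\<Union>C \<in> S"
      using C \<open>C \<noteq> {}\<close> by (auto simp: S_def)
  qed
  then obtain P where "P \<in> S" and max_S: "\<And>J. J \<in> S \<Longrightarrow> P \<subseteq> J \<Longrightarrow> J = P"
    by blast
  then have P: "ideal P" "1 \<notin> P" "I \<subseteq> P"
    by (auto simp: S_def)
  have max: "J = P" if "ideal J" "1 \<notin> J" "P \<subseteq> J" for J
    using that P(3) by (intro max_S) (auto simp: S_def)
  have comaximal: "\<exists>m\<in>P. \<exists>c\<in>A. 1 = m + c * a" if a: "a \<in> A" "a \<notin> P" for a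
  proof -
    define J where "J = {m + c * a | m c. m \<in> P \<and> c \<in> A}"
    have "ideal J"
      unfolding ideal_def
    proof (intro conjI ballI)
      show "J \<subseteq> A"
        unfolding J_def using a(1) ideal_subset[OF P(1)] A_add A_mult by blast
      show "0 \<in> J"
        unfolding J_def using A_0 ideal_0[OF P(1)] by (intro CollectI exI[of _ 0]) auto
    next
      fix f g assume "f \<in> J" "g \<in> J"
      then obtain m c m' c' where *: "f = m + c * a" "g = m' + c' * a" "m \<in> P" "m' \<in> P"
          "c \<in> A" "c' \<in> A"
        by (auto simp: J_def)
      then have "f + g = (m + m') + (c + c') * a"
        by (simp add: algebra_simps)
      then show "f + g \<in> J"
        unfolding J_def using * ideal_add[OF P(1)] A_add by blast
    next
      fix f g assume "f \<in> J" "g \<in> A"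
      then obtain m c where *: "f = m + c * a" "m \<in> P" "c \<in> A"
        by (auto simp: J_def)
      then have "g * f = g * m + (g * c) * a"
        by (simp add: algebra_simps)
      then show "g * f \<in> J"
        unfolding J_def using * \<open>g \<in> A\<close> ideal_mult[OF P(1)] A_mult by blast
    qed
    moreover have "m \<in> J" if "m \<in> P" for m
      unfolding J_def using that A_0 by (intro CollectI exI[of _ m] exI[of _ 0]) auto
    moreover have "a \<in> J"
      unfolding J_def using ideal_0[OF P(1)] A_1 by (intro CollectI exI[of _ 0] exI[of _ 1]) auto
    ultimately have "1 \<in> J"
      using max[of J] a(2) by blast
    then show ?thesis
      by (auto simp: J_def)
  qed
  have "a \<in> P \<or> b \<in> P" if ab: "a \<in> A" "b \<in> A" "a * b \<in> P" for a b
  proof (rule ccontr)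
    assume "\<not> (a \<in> P \<or> b \<in> P)"
    then obtain m c m' c' where *: "m \<in> P" "c \<in> A" "1 = m + c * a" "m' \<in> P" "c' \<in> A" "1 = m' + c' * b"
      using comaximal[of a] comaximal[of b] ab by auto
    have "1 = m + (c * a) * (m' + c' * b)"
      using *(3) unfolding *(6)[symmetric] by simp
    also have "\<dots> = m + ((c * a) * m' + (c * c') * (a * b))"
      by (simp add: algebra_simps)
    also have "\<dots> \<in> P"
      by (intro ideal_add[OF P(1)] ideal_mult[OF P(1)] A_mult * ab)
    finally show False
      using P(2) by simp
  qed
  then show ?thesis
    using P by (auto simp: prime_ideal_def)
qed

end

text \<open>
  The localization of \<open>A\<close> at a nonzero prime ideal \<open>P\<close> is a discrete valuation ring whose maximal
  ideal is generated by \<open>\<pi>(z)\<close>, where \<open>\<pi>\<close> is a minimal polynomial of \<open>z\<close> modulo \<open>P\<close>: the curve is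
  unramified over the affine \<open>z\<close>-line.
\<close>

locale curve_prime = curve_at_infinity K q n M x y z vinf
  for K :: "'a::field set" and q n M and x y z :: 'a and vinf +
  fixes P :: "'a set" and \<pi> :: "'a poly"
  assumes P: "prime_ideal P"
    and \<pi>: "\<pi> \<in> polys" "\<pi> \<noteq> 0" "poly \<pi> z \<in> P"
    and \<pi>_minimal: "\<And>p. p \<in> polys \<Longrightarrow> p \<noteq> 0 \<Longrightarrow> poly p z \<in> P \<Longrightarrow> degree \<pi> \<le> degree p"
begin

definition t :: 'a where
  "t = poly \<pi> z"

lemma P_ideal: "ideal P" and P_1: "1 \<notin> P"
  and P_prime: "a \<in> A \<Longrightarrow> b \<in> A \<Longrightarrow> a * b \<in> P \<Longrightarrow> a \<in> P \<or> b \<in> P"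
  using P by (auto simp: prime_ideal_def)

lemma P_power: "a \<in> A \<Longrightarrow> a ^ k \<in> P \<Longrightarrow> a \<in> P"
  by (induction k) (use P_1 P_prime A_power in auto)

lemma t_A: "t \<in> A" and t_P: "t \<in> P" and t_0: "t \<noteq> 0"
  using \<pi> z_transcendental ideal_subset[OF P_ideal] by (auto simp: t_def)

lemma units_1: "1 \<in> A - P"
  using A_1 P_1 by simp

lemma units_mult: "a \<in> A - P \<Longrightarrow> b \<in> A - P \<Longrightarrow> a * b \<in> A - P"
  using P_prime A_mult by auto

lemma units_K: "c \<in> K \<Longrightarrow> c \<noteq> 0 \<Longrightarrow> c \<in> A - P"
  using ideal_mult[OF P_ideal, of c "inverse c"] P_1 by (auto intro: A_const K_inverse)

lemma units_nonzero: "a \<in> A - P \<Longrightarrow> a \<noteq> 0"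
  using ideal_0[OF P_ideal] by auto

text \<open>
  The remainder modulo \<open>\<pi>\<close> also vanishes modulo \<open>P\<close>, so minimality of the degree forces it to be
  \<open>0\<close>.
\<close>

lemma \<pi>_divides:
  assumes "p \<in> polys" "poly p z \<in> P"
  shows "\<exists>s\<in>polys. p = s * \<pi>"
proof -
  obtain s r where *: "s \<in> polys" "r \<in> polys" "p = s * \<pi> + r" "r = 0 \<or> degree r < degree \<pi>"
    using polys_division[OF \<pi>(1,2) assms(1)] by auto
  have "poly r z = poly p z - poly s z * t"
    by (simp add: *(3) t_def)
  also have "\<dots> \<in> P"
    using assms * t_P A_xyz by (intro ideal_diff[OF P_ideal] ideal_mult[OF P_ideal] A_poly) auto
  finally have "r = 0"
    using \<pi>_minimal[of r] * by force
  then show ?thesis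
    using * by auto
qed

lemma degree_\<pi>: "0 < degree \<pi>"
proof (rule ccontr)
  assume "\<not> 0 < degree \<pi>"
  then obtain c where "\<pi> = [:c:]"
    using degree_eq_zeroE by blast
  then have "c \<in> K" "c \<noteq> 0" "c \<in> P"
    using \<pi> by (auto simp: polys_pCons)
  then show False
    using units_K by blast
qed

lemma poly_factorization:
  assumes "p \<in> polys" "p \<noteq> 0"
  shows "\<exists>j. \<exists>g\<in>A - P. poly p z = t ^ j * g"
  using assms
proof (induction "degree p" arbitrary: p rule: less_induct)
  case less
  show ?case
  proof (cases "poly p z \<in> P")
    case False
    then show ?thesis
      using A_poly[OF A_xyz(3) less(2)] by (intro exI[of _ 0] bexI[of _ "poly p z"]) auto
  next
    case True
    then obtain s where s: "s \<in> polys" "p = s * \<pi>"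
      using \<pi>_divides less by blast
    then have "s \<noteq> 0"
      using less by auto
    then have "degree s < degree p"
      using s \<pi> degree_\<pi> by (simp add: degree_mult_eq)
    then obtain j g where "g \<in> A - P" "poly s z = t ^ j * g"
      using less(1)[of s] s \<open>s \<noteq> 0\<close> by auto
    then show ?thesis
      using s by (intro exI[of _ "Suc j"] bexI[of _ g]) (auto simp: t_def)
  qed
qed

definition T :: "'a set" where
  "T = {t * b | b. b \<in> A}"

lemma T_ideal: "ideal T"
  unfolding ideal_def
proof (intro conjI ballI)
  show "T \<subseteq> A" "0 \<in> T"
    using t_A A_0 by (auto simp: T_def intro: A_mult)
  show "a + b \<in> T" if "a \<in> T" "b \<in> T" for a b
    using that A_add by (auto simp: T_def simp flip: distrib_left)
  show "b * a \<in> T" if "a \<in> T" "b \<in> A" for a b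
    using that A_mult by (auto simp: T_def mult.left_commute)
qed

lemma q_power_pos: "0 < q ^ k"
  using q_gt_1 by simp

text \<open>
  As \<open>K[z] / \<pi>\<close> is finite, two of the powers of \<open>z\<close> with exponents \<open>card K ^ i\<close> are congruent;
  this is a Frobenius power of the desired one, and \<open>P\<close> is prime.
\<close>

lemma z_frobenius: "\<exists>D>0. z ^ (q ^ (2 * n * D)) - z \<in> T"
proof -
  have "\<exists>r\<in>polys_lt (degree \<pi>). z ^ k - poly r z \<in> P" for k
  proof -
    obtain s r where *: "s \<in> polys" "r \<in> polys" "monom 1 k = s * \<pi> + r" "r = 0 \<or> degree r < degree \<pi>"
      using polys_division[OF \<pi>(1,2) polys_monom[OF K_1, of k]] by auto
    have "z ^ k = poly s z * t + poly r z"
      using arg_cong[OF *(3), of "\<lambda>p. poly p z"] by (simp add: poly_monom t_def)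
    then have "z ^ k - poly r z = poly s z * t"
      by simp
    then have "z ^ k - poly r z \<in> P"
      using * t_P by (auto intro!: ideal_mult[OF P_ideal] A_poly A_xyz)
    moreover have "r \<in> polys_lt (degree \<pi>)"
      using * by (auto simp: polys_lt_def coeff_eq_0)
    ultimately show ?thesis
      by blast
  qed
  then have "\<forall>k. \<exists>r. r \<in> polys_lt (degree \<pi>) \<and> z ^ k - poly r z \<in> P"
    by blast
  from choice[OF this] obtain r
    where "\<forall>k. r k \<in> polys_lt (degree \<pi>) \<and> z ^ k - poly (r k) z \<in> P" ..
  then have r: "r k \<in> polys_lt (degree \<pi>)" "z ^ k - poly (r k) z \<in> P" for k
    by simp_all
  define f where "f i = r (q ^ (2 * n * i))" for i
  have "range f \<subseteq> polys_lt (degree \<pi>)"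
    using r(1) by (auto simp: f_def)
  then have "finite (range f)"
    using card_polys_lt[OF finite_K] finite_subset by blast
  then have "\<not> inj f"
    using finite_imageD infinite_UNIV_nat by blast
  then obtain i' j' where "f i' = f j'" "i' \<noteq> j'"
    by (auto simp: inj_def)
  then obtain i j where "f i = f j" "i < j"
    by (metis nat_neq_iff)
  then have ij: "r (q ^ (2 * n * i)) = r (q ^ (2 * n * j))" "i < j"
    by (simp_all add: f_def)
  define D where "D = j - i"
  have j: "j = D + i"
    using ij by (simp add: D_def)
  let ?w = "z ^ (q ^ (2 * n * D)) - z"
  have "?w ^ (q ^ (2 * n * i)) = z ^ (q ^ (2 * n * j)) - z ^ (q ^ (2 * n * i))"
    by (simp add: frobenius_diff j distrib_left power_add power_mult[symmetric])
  also have "\<dots> = (z ^ (q ^ (2 * n * j)) - poly (r (q ^ (2 * n * j))) z) -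
      (z ^ (q ^ (2 * n * i)) - poly (r (q ^ (2 * n * i))) z)"
    using ij(1) by simp
  also have "\<dots> \<in> P"
    by (intro ideal_diff[OF P_ideal] r)
  finally have "?w \<in> P"
    by (rule P_power[rotated]) (intro A_diff A_power A_xyz)
  moreover have "?w = poly (monom 1 (q ^ (2 * n * D)) - monom 1 1) z"
    by (simp add: poly_monom)
  moreover have "monom 1 (q ^ (2 * n * D)) - monom 1 1 \<in> polys"
    by (intro polys_diff polys_monom K_1)
  ultimately obtain s where "s \<in> polys" "monom 1 (q ^ (2 * n * D)) - monom 1 1 = s * \<pi>"
    using \<pi>_divides by metis
  then have "?w = t * poly s z" "poly s z \<in> A"
    using \<open>?w = _\<close> A_poly[OF A_xyz(3)] by (simp_all add: t_def mult.commute)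
  then have "?w \<in> T"
    by (auto simp: T_def)
  then show ?thesis
    using ij(2) by (intro exI[of _ D]) (auto simp: D_def)
qed

text \<open>
  The elements whose residues modulo \<open>t\<close> lie in the fixed ring of the \<open>k\<close>-th power of the
  \<open>q\<close>-Frobenius map.
\<close>

definition fixed :: "nat \<Rightarrow> 'a set" where
  "fixed k = {a \<in> A. a ^ (q ^ k) - a \<in> T}"

lemma fixed_add: "a \<in> fixed k \<Longrightarrow> b \<in> fixed k \<Longrightarrow> a + b \<in> fixed k"
proof -
  assume *: "a \<in> fixed k" "b \<in> fixed k"
  have "(a + b) ^ (q ^ k) - (a + b) = (a ^ (q ^ k) - a) + (b ^ (q ^ k) - b)"
    by (simp add: frobenius_add)
  also have "\<dots> \<in> T"
    using * by (intro ideal_add[OF T_ideal]) (auto simp: fixed_def)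
  finally show ?thesis
    using * by (auto simp: fixed_def intro: A_add)
qed

lemma fixed_mult: "a \<in> fixed k \<Longrightarrow> b \<in> fixed k \<Longrightarrow> a * b \<in> fixed k"
proof -
  assume *: "a \<in> fixed k" "b \<in> fixed k"
  have "(a * b) ^ (q ^ k) - a * b = a ^ (q ^ k) * (b ^ (q ^ k) - b) + b * (a ^ (q ^ k) - a)"
    by (simp add: power_mult_distrib algebra_simps)
  also have "\<dots> \<in> T"
    using * by (intro ideal_add[OF T_ideal] ideal_mult[OF T_ideal] A_power) (auto simp: fixed_def)
  finally show ?thesis
    using * by (auto simp: fixed_def intro: A_mult)
qed

lemma fixed_iterate: "a \<in> fixed k \<Longrightarrow> a \<in> fixed (k * l)"
proof (induction l)
  case 0
  then show ?case
    using ideal_0[OF T_ideal] by (simp add: fixed_def)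
next
  case (Suc l)
  then have *: "a \<in> A" "a ^ (q ^ k) - a \<in> T" "a ^ (q ^ (k * l)) - a \<in> T"
    by (auto simp: fixed_def)
  have "a ^ (q ^ (k * Suc l)) - a = (a ^ (q ^ (k * l)) - a) ^ (q ^ k) + (a ^ (q ^ k) - a)"
    by (simp add: frobenius_diff power_add mult.commute power_mult[symmetric])
  also have "\<dots> \<in> T"
    using * q_power_pos by (intro ideal_add[OF T_ideal] ideal_power[OF T_ideal]) auto
  finally show ?case
    using * by (simp add: fixed_def)
qed

lemma fixed_K: "c \<in> K \<Longrightarrow> c \<in> fixed (2 * n * l)"
proof (rule fixed_iterate)
  show "c \<in> K \<Longrightarrow> c \<in> fixed (2 * n)"
    using frobenius_K[of c] ideal_0[OF T_ideal] by (simp add: fixed_def A_const card_K)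
qed

lemma fixed_power: "0 < k \<Longrightarrow> a \<in> fixed k \<Longrightarrow> a ^ i \<in> fixed k"
proof (induction i)
  case 0
  then show ?case
    using ideal_0[OF T_ideal] by (simp add: fixed_def A_1)
qed (auto intro: fixed_mult)

text \<open>
  The additive form of the defining equations enters here: if Frobenius moves \<open>c\<close> by an amount \<open>w\<close>
  that is itself periodic, then after \<open>p\<close> periods, \<open>p\<close> being the characteristic, \<open>c\<close> has moved by
  \<open>p\<close> congruent amounts, that is, by \<open>0\<close>.
\<close>

lemma fixed_artin_schreier:
  assumes c: "c \<in> A" "c ^ (q ^ k) = c + w" and w: "w \<in> fixed (k * m)"
  shows "c \<in> fixed (k * m * CHAR('a))"
proof -
  let ?p = "CHAR('a)"
  define g where "g i = w ^ (q ^ (k * i))" for i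
  have g_A: "g i \<in> A" for i
    using w by (auto simp: g_def fixed_def intro: A_power)
  have moved: "c ^ (q ^ (k * l)) = c + (\<Sum>i<l. g i)" for l
  proof (induction l)
    case (Suc l)
    have "c ^ (q ^ (k * Suc l)) = (c ^ (q ^ k)) ^ (q ^ (k * l))"
      by (simp add: power_add power_mult[symmetric])
    also have "\<dots> = c ^ (q ^ (k * l)) + g l"
      by (simp add: c(2) frobenius_add g_def)
    finally show ?case
      by (simp add: Suc.IH add.assoc)
  qed simp
  have periodic: "g (l * m + i) - g i \<in> T" for l i
  proof -
    have "w ^ (q ^ (k * m * l)) - w \<in> T"
      using fixed_iterate[OF w, of l] by (simp add: fixed_def)
    then have "(w ^ (q ^ (k * m * l)) - w) ^ (q ^ (k * i)) \<in> T"
      using q_power_pos by (intro ideal_power[OF T_ideal])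
    moreover have "(w ^ (q ^ (k * m * l)) - w) ^ (q ^ (k * i)) = g (l * m + i) - g i"
      by (simp add: frobenius_diff g_def power_mult[symmetric] power_add[symmetric] algebra_simps)
    ultimately show ?thesis
      by simp
  qed
  have "(\<Sum>i<?p * m. g i) = (\<Sum>l<?p. \<Sum>i<m. g (l * m + i))"
  proof -
    have "(\<Sum>i<?p * m. g i) = (\<Sum>l<?p. sum g {l * m..<l * m + m})"
      by (rule sum.nat_group[symmetric])
    also have "\<dots> = (\<Sum>l<?p. \<Sum>i<m. g (l * m + i))"
    proof (rule sum.cong)
      fix l
      show "sum g {l * m..<l * m + m} = (\<Sum>i<m. g (l * m + i))"
        using sum.shift_bounds_nat_ivl[of g 0 "l * m" m] by (simp add: atLeast0LessThan add.commute)
    qed simp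
    finally show ?thesis .
  qed
  also have "\<dots> = (\<Sum>l<?p. \<Sum>i<m. g (l * m + i) - g i) + of_nat ?p * (\<Sum>i<m. g i)"
    by (simp add: sum_subtractf)
  also have "\<dots> = (\<Sum>l<?p. \<Sum>i<m. g (l * m + i) - g i)"
    by simp
  also have "\<dots> \<in> T"
    by (intro ideal_sum[OF T_ideal] periodic)
  finally have "c ^ (q ^ (k * (?p * m))) - c \<in> T"
    unfolding moved by simp
  then show ?thesis
    using c by (simp add: fixed_def ac_simps)
qed

text \<open>
  Iterating the equations gives \<open>y\<^bsup>q\<^sup>2\<^esup> = y + z\<^bsup>M\<^esup>\<close> and \<open>x\<^bsup>q\<^sup>2\<^esup> = x + w\<close> with \<open>w\<close> a polynomial in
  \<open>y\<close>, so periodicity passes from \<open>z\<close> to \<open>y\<close> and from \<open>y\<close> to \<open>x\<close>.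
\<close>

lemma A_fixed: "\<exists>k>0. A \<subseteq> fixed k"
proof -
  let ?p = "CHAR('a)"
  obtain D where D: "0 < D" "z ^ (q ^ (2 * n * D)) - z \<in> T"
    using z_frobenius by blast
  have p: "0 < ?p"
    using q_CHAR(1) by (rule prime_gt_0_nat)
  define k where "k = 2 * (n * D)"
  have k: "0 < k" "k = 2 * n * D"
    using D n_pos by (simp_all add: k_def)
  have z: "z \<in> fixed k"
    using D A_xyz by (simp add: fixed_def k)
  have "y ^ (q ^ 2) = y + z ^ M"
    using eq_yz by (simp add: algebra_simps)
  then have y: "y \<in> fixed (k * ?p)"
    using fixed_artin_schreier[of y 2 "z ^ M" "n * D"] fixed_power[OF k(1) z] A_xyz
    by (simp add: k_def)
  have xq: "x ^ q = y ^ (q + 1) - x"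
    using eq_xy by (simp add: algebra_simps)
  have "x ^ (q ^ 2) = (x ^ q) ^ q"
    by (simp add: power2_eq_square power_mult)
  also have "\<dots> = (y ^ (q + 1)) ^ q - x ^ q"
    using frobenius_diff[of "y ^ (q + 1)" x 1] by (simp only: xq power_one_right)
  also have "\<dots> = x + (y ^ ((q + 1) * q) + (- 1) * y ^ (q + 1))"
    unfolding power_mult[symmetric] xq by simp
  finally have "x ^ (q ^ 2) = x + (y ^ ((q + 1) * q) + (- 1) * y ^ (q + 1))" .
  moreover have "y ^ ((q + 1) * q) + (- 1) * y ^ (q + 1) \<in> fixed (k * ?p)"
    using y k p fixed_K[of "- 1" "D * ?p"] K_uminus[OF K_1]
    by (intro fixed_add fixed_mult fixed_power) (auto simp: mult.assoc)
  ultimately have x: "x \<in> fixed (k * ?p * ?p)"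
    using fixed_artin_schreier[of x 2 _ "n * D * ?p"] A_xyz by (simp add: k_def mult.assoc)
  have zy: "z \<in> fixed (k * ?p * ?p)" "y \<in> fixed (k * ?p * ?p)"
    using fixed_iterate[OF fixed_iterate[OF z]] fixed_iterate[OF y] by auto
  have "a \<in> fixed (k * ?p * ?p)" if "a \<in> A" for a
    using that
  proof (induction rule: A.induct)
    case (A_const c)
    then show ?case
      using fixed_K[of c "D * ?p * ?p"] by (simp add: k mult.assoc)
  qed (use x zy in \<open>auto intro: fixed_add fixed_mult\<close>)
  then show ?thesis
    using k p by (intro exI[of _ "k * ?p * ?p"]) auto
qed

text \<open>
  The congruence \<open>b\<^bsup>R\<^esup> = b\<close> modulo \<open>t\<close> holds for some power \<open>R > 1\<close> of \<open>q\<close>, so \<open>b\<close> is annihilated by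
  \<open>1 - b\<^bsup>R - 1\<^esup>\<close>, which is outside \<open>P\<close>.
\<close>

lemma uniformizer:
  assumes b: "b \<in> P"
  shows "\<exists>e\<in>A - P. \<exists>c\<in>A. e * b = t * c"
proof -
  obtain k where k: "0 < k" "A \<subseteq> fixed k"
    using A_fixed by blast
  have bA: "b \<in> A"
    using b ideal_subset[OF P_ideal] by blast
  define R where "R = q ^ k"
  have R: "1 < R"
    unfolding R_def using k by (intro one_less_power q_gt_1)
  define e where "e = 1 - b ^ (R - 1)"
  have "b ^ (R - 1) \<in> P"
    using R b by (intro ideal_power[OF P_ideal]) auto
  then have "e \<notin> P"
    using ideal_add[OF P_ideal, of e "b ^ (R - 1)"] P_1 by (auto simp: e_def)
  moreover have "e \<in> A"
    using bA by (auto simp: e_def intro: A_diff A_1 A_power)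
  moreover have "e * b = b - b ^ R"
    using R power_Suc2[of b "R - 1"] by (simp add: e_def algebra_simps)
  moreover have "b - b ^ R \<in> T"
    using k bA ideal_diff[OF T_ideal ideal_0[OF T_ideal], of "b ^ R - b"]
    by (auto simp: fixed_def R_def)
  ultimately have "e \<in> A - P" "e * b \<in> T"
    by auto
  then show ?thesis
    by (force simp: T_def)
qed

text \<open>
  Factors \<open>t\<close> can be split off only finitely often: \<open>a\<close> divides a nonzero polynomial in \<open>z\<close>, in
  which \<open>t\<close> occurs with a finite exponent.
\<close>

lemma local_factorization:
  assumes "a \<in> A" "a \<noteq> 0"
  shows "\<exists>k. \<exists>u\<in>A - P. \<exists>w\<in>A - P. u * a = t ^ k * w"
proof -
  have *: "\<exists>k. \<exists>u\<in>A - P. \<exists>w\<in>A - P. u * a = t ^ k * w"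
    if "a \<in> A" "b \<in> A" "g \<in> A - P" "a * b = t ^ j * g" for j a b g
    using that
  proof (induction j arbitrary: a b g)
    case 0
    then have "a \<notin> P"
      using ideal_mult'[OF P_ideal, of a b] by auto
    then show ?case
      using 0 units_1 by (intro exI[of _ 0] bexI[of _ 1] bexI[of _ a]) auto
  next
    case (Suc j)
    show ?case
    proof (cases "a \<in> P")
      case False
      then show ?thesis
        using Suc.prems units_1 by (intro exI[of _ 0] bexI[of _ 1] bexI[of _ a]) auto
    next
      case True
      then obtain e c where e: "e \<in> A - P" "c \<in> A" "e * a = t * c"
        using uniformizer by blast
      have "t * (c * b) = e * (a * b)"
        using e(3) by (metis mult.assoc)
      also have "\<dots> = t * (t ^ j * (e * g))"
        unfolding Suc.prems(4) by (simp add: algebra_simps)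
      finally have "c * b = t ^ j * (e * g)"
        using t_0 by simp
      then obtain k u w where *: "u \<in> A - P" "w \<in> A - P" "u * c = t ^ k * w"
        using Suc.IH[OF e(2) Suc.prems(2) units_mult[OF e(1) Suc.prems(3)]] by auto
      have "(u * e) * a = t * (u * c)"
        by (simp only: mult.assoc e(3) mult.left_commute)
      then have "(u * e) * a = t ^ Suc k * w"
        by (simp add: *(3) mult.assoc)
      then show ?thesis
        using * units_mult[OF *(1) e(1)] by blast
    qed
  qed
  obtain p b where p: "p \<in> polys" "p \<noteq> 0" "b \<in> A" "poly p z = a * b"
    using multiple_in_polys[OF assms] by auto
  obtain j g where g: "g \<in> A - P" "poly p z = t ^ j * g"
    using poly_factorization[OF p(1,2)] by auto
  show ?thesis
    using g(2) unfolding p(4) by (rule *[OF assms(1) p(3) g(1)])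
qed

text \<open>That is, \<open>f\<close> is \<open>t\<^bsup>k\<^esup>\<close> times a unit \<open>w / u\<close> of the localization.\<close>

definition valued :: "'a \<Rightarrow> int \<Rightarrow> bool" where
  "valued f k \<longleftrightarrow> (\<exists>u\<in>A - P. \<exists>w\<in>A - P. f * u = t powi k * w)"

lemma valued_A: "a \<in> A \<Longrightarrow> a \<noteq> 0 \<Longrightarrow> \<exists>k\<ge>0. valued a k"
  using local_factorization[of a] unfolding valued_def
  by (metis mult.commute of_nat_0_le_iff power_int_of_nat)

lemma valued_mult: "valued f k \<Longrightarrow> valued g l \<Longrightarrow> valued (f * g) (k + l)"
proof -
  assume "valued f k" "valued g l"
  then obtain u w u' w' where *: "u \<in> A - P" "w \<in> A - P" "f * u = t powi k * w"
      "u' \<in> A - P" "w' \<in> A - P" "g * u' = t powi l * w'"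
    by (auto simp: valued_def)
  have "(f * g) * (u * u') = (f * u) * (g * u')"
    by (simp add: ac_simps)
  also have "\<dots> = t powi (k + l) * (w * w')"
    unfolding *(3,6) using t_0 by (simp add: power_int_add ac_simps)
  finally show ?thesis
    using units_mult *(1,2,4,5) unfolding valued_def by blast
qed

lemma valued_inverse: "valued f k \<Longrightarrow> valued (inverse f) (- k)"
proof -
  assume "valued f k"
  then obtain u w where *: "u \<in> A - P" "w \<in> A - P" "f * u = t powi k * w"
    by (auto simp: valued_def)
  then have "f \<noteq> 0"
    using t_0 units_nonzero by fastforce
  then have "inverse f * w = t powi (- k) * u"
    using *(3) t_0 by (simp add: power_int_minus field_simps)
  then show ?thesis
    using * unfolding valued_def by blast
qed

lemma valued_exists: "f \<noteq> 0 \<Longrightarrow> \<exists>k. valued f k"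
proof -
  assume "f \<noteq> 0"
  obtain a b where *: "a \<in> A" "b \<in> A" "b \<noteq> 0" "f = a / b"
    by (rule fraction)
  then have "a \<noteq> 0"
    using \<open>f \<noteq> 0\<close> by auto
  then show ?thesis
    using * valued_A[of a] valued_A[of b] valued_mult valued_inverse
    unfolding divide_inverse by metis
qed

lemma valued_unique: "valued f k \<Longrightarrow> valued f l \<Longrightarrow> k = l"
proof -
  have False if less: "k < l" and *: "valued f k" "valued f l" for k l
  proof -
    obtain u w u' w' where *: "u \<in> A - P" "w \<in> A - P" "f * u = t powi k * w"
        "u' \<in> A - P" "w' \<in> A - P" "f * u' = t powi l * w'"
      using * by (auto simp: valued_def)
    define m where "m = nat (l - k) - 1"
    have l: "l = k + int (Suc m)"
      using less by (simp add: m_def)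
    have "t powi k * (w * u') = (f * u) * u'"
      by (simp add: *(3))
    also have "\<dots> = (f * u') * u"
      by (simp add: ac_simps)
    also have "\<dots> = t powi k * (t powi int (Suc m) * w' * u)"
      using t_0 unfolding *(6) l by (simp add: power_int_add[of t] ac_simps del: of_nat_Suc)
    also have "t powi int (Suc m) = t * t ^ m"
      by (simp only: power_int_of_nat power_Suc)
    finally have "w * u' = t * (t ^ m * w' * u)"
      using t_0 by (simp add: ac_simps)
    also have "\<dots> \<in> P"
      using * t_P by (intro ideal_mult'[OF P_ideal] A_mult A_power t_A) auto
    finally show False
      using units_mult *(2,4) by blast
  qed
  then show "valued f k \<Longrightarrow> valued f l \<Longrightarrow> k = l"
    by (meson linorder_neqE_linordered_idom)
qed

lemma valued_add:
  assumes "valued f k" "valued g l" "k \<le> l" "f + g \<noteq> 0"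
  shows "\<exists>m\<ge>k. valued (f + g) m"
proof -
  obtain u w u' w' where *: "u \<in> A - P" "w \<in> A - P" "f * u = t powi k * w"
      "u' \<in> A - P" "w' \<in> A - P" "g * u' = t powi l * w'"
    using assms(1,2) by (auto simp: valued_def)
  define d where "d = nat (l - k)"
  have l: "l = k + int d"
    using assms by (simp add: d_def)
  define c where "c = w * u' + t ^ d * w' * u"
  have "(f + g) * (u * u') = (f * u) * u' + (g * u') * u"
    by (simp add: algebra_simps)
  also have "\<dots> = t powi k * c"
    using t_0 unfolding *(3,6) l by (simp add: power_int_add c_def algebra_simps)
  finally have eq: "(f + g) * (u * u') = t powi k * c" .
  have "c \<noteq> 0"
    using eq assms(4) units_nonzero *(1,4) by auto
  moreover have "c \<in> A"
    unfolding c_def using * by (intro A_add A_mult A_power t_A) auto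
  ultimately obtain i where i: "0 \<le> i" "valued c i"
    using valued_A by blast
  have "valued (t powi k * inverse (u * u')) (k + - 0)"
    using units_1 units_mult[OF *(1,4)]
    by (intro valued_mult valued_inverse) (auto simp: valued_def intro!: bexI[of _ 1])
  from valued_mult[OF this i(2)]
  have "valued (t powi k * c * inverse (u * u')) (k + i)"
    by (simp add: ac_simps)
  moreover have "f + g = (f + g) * (u * u') * inverse (u * u')"
    using units_nonzero[OF units_mult[OF *(1,4)]]
    by (metis mult.assoc mult_1_right right_inverse)
  ultimately have "valued (f + g) (k + i)"
    unfolding eq by simp
  then show ?thesis
    using i(1) by (intro exI[of _ "k + i"]) auto
qed

definition v\<^sub>P :: "'a \<Rightarrow> int" where
  "v\<^sub>P f = (if f = 0 then 0 else THE k. valued f k)"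

lemma v\<^sub>P_eq: "f \<noteq> 0 \<Longrightarrow> valued f k \<Longrightarrow> v\<^sub>P f = k"
  unfolding v\<^sub>P_def using valued_unique by auto

lemma valued_v\<^sub>P: "f \<noteq> 0 \<Longrightarrow> valued f (v\<^sub>P f)"
  using valued_exists v\<^sub>P_eq by metis

lemma place_v\<^sub>P: "place K v\<^sub>P"
  unfolding place_def
proof (intro conjI allI impI ballI)
  show "v\<^sub>P 0 = 0"
    by (simp add: v\<^sub>P_def)
  show "v\<^sub>P (a * b) = v\<^sub>P a + v\<^sub>P b" if "a \<noteq> 0" "b \<noteq> 0" for a b
    using that by (intro v\<^sub>P_eq valued_mult valued_v\<^sub>P) auto
  show "min (v\<^sub>P a) (v\<^sub>P b) \<le> v\<^sub>P (a + b)" if ab: "a \<noteq> 0" "b \<noteq> 0" "a + b \<noteq> 0" for a b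
  proof -
    have *: "v\<^sub>P a \<le> v\<^sub>P (a + b)" if "a \<noteq> 0" "b \<noteq> 0" "a + b \<noteq> 0" "v\<^sub>P a \<le> v\<^sub>P b" for a b
      using valued_add[OF valued_v\<^sub>P valued_v\<^sub>P, of a b] v\<^sub>P_eq that by metis
    show ?thesis
      using *[of a b] *[of b a] ab by (auto simp: min_def add.commute)
  qed
  have "valued t 1"
    unfolding valued_def using units_1 by (intro bexI[of _ 1]) auto
  then show "\<exists>t. t \<noteq> 0 \<and> v\<^sub>P t = 1"
    using t_0 v\<^sub>P_eq by blast
  show "v\<^sub>P c = 0" if "c \<in> K" for c
  proof (cases "c = 0")
    case False
    then have "valued c 0"
      unfolding valued_def using units_1 units_K[OF that] by (intro bexI[of _ 1] bexI[of _ c]) auto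
    then show ?thesis
      using False v\<^sub>P_eq by blast
  qed (simp add: v\<^sub>P_def)
qed

lemma v\<^sub>P_A: "a \<in> A \<Longrightarrow> 0 \<le> v\<^sub>P a"
  using valued_A[of a] v\<^sub>P_eq[of a] by (cases "a = 0") (auto simp: v\<^sub>P_def)

lemma v\<^sub>P_nonneg: "0 \<le> v\<^sub>P f \<Longrightarrow> \<exists>u\<in>A - P. u * f \<in> A"
proof (cases "f = 0")
  case True
  then show ?thesis
    using units_1 A_0 by auto
next
  case False
  assume "0 \<le> v\<^sub>P f"
  then obtain k where k: "v\<^sub>P f = int k"
    using zero_le_imp_eq_int by blast
  obtain u w where *: "u \<in> A - P" "w \<in> A - P" "f * u = t powi (v\<^sub>P f) * w"
    using valued_v\<^sub>P[OF False] by (auto simp: valued_def)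
  then have "u * f = t ^ k * w"
    unfolding k by (simp add: mult.commute)
  also have "\<dots> \<in> A"
    using * by (intro A_mult A_power t_A) auto
  finally show ?thesis
    using * by blast
qed

end

context curve_at_infinity
begin

text \<open>
  The denominators of \<open>f\<close> form an ideal of \<open>A\<close>. If it is proper, it lies in a prime ideal, and \<open>f\<close>
  has a pole at the corresponding place.
\<close>

theorem regular_imp_in_A:
  assumes reg: "\<And>v. place K v \<Longrightarrow> v \<noteq> vinf \<Longrightarrow> 0 \<le> v f"
  shows "f \<in> A"
proof (rule ccontr)
  assume f: "f \<notin> A"
  define I where "I = {b \<in> A. b * f \<in> A}"
  have I: "ideal I"
    unfolding ideal_def I_def by (auto simp: A_0 distrib_right mult.assoc intro: A_add A_mult)
  have "1 \<notin> I"
    using f by (simp add: I_def)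
  then obtain P where prime: "prime_ideal P" and I_P: "I \<subseteq> P"
    using prime_ideal_exists[OF I] by blast
  obtain a b where ab: "a \<in> A" "b \<in> A" "b \<noteq> 0" "f = a / b"
    by (rule fraction)
  then have "b \<in> I"
    by (simp add: I_def)
  obtain p c where p: "p \<in> polys" "c \<in> A" "p \<noteq> 0" "poly p z = b * c"
    using multiple_in_polys[OF ab(2,3)] by blast
  then have "poly p z \<in> P"
    using \<open>b \<in> I\<close> I_P ideal_mult'[OF I] by auto
  define good where "good r \<longleftrightarrow> r \<in> polys \<and> r \<noteq> 0 \<and> poly r z \<in> P" for r
  have "good p"
    using p \<open>poly p z \<in> P\<close> by (simp add: good_def)
  then obtain \<pi> where \<pi>: "good \<pi>" "\<And>r. good r \<Longrightarrow> degree \<pi> \<le> degree r"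
    using ex_has_least_nat[of good p degree] by blast
  interpret curve_prime K q n M x y z vinf P \<pi>
    by unfold_locales (use prime \<pi> in \<open>auto simp: good_def\<close>)
  have "v\<^sub>P \<noteq> vinf"
    using v\<^sub>P_A[OF A_xyz(3)] pole_xz by auto
  then have "0 \<le> v\<^sub>P f"
    using reg place_v\<^sub>P by blast
  then obtain u where "u \<in> A - P" "u * f \<in> A"
    using v\<^sub>P_nonneg by blast
  then show False
    using I_P by (auto simp: I_def)
qed

end

section \<open>The generalized Weierstrass semigroup\<close>

locale curve_points = curve_at_infinity K q n M x y z vinf
  for K :: "'a::field set" and q n M and x y z :: 'a and vinf +
  fixes m :: nat and \<alpha> :: "nat \<Rightarrow> 'a" and P :: "nat \<Rightarrow> 'a \<Rightarrow> int"
  assumes m: "1 \<le> m" "m \<le> q"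
    and \<alpha>_inj: "inj_on \<alpha> {1..q}"
    and \<alpha>_root: "\<And>i. i \<in> {1..q} \<Longrightarrow> \<alpha> i \<in> K \<and> \<alpha> i ^ q + \<alpha> i = 0"
    and P: "\<And>i. i \<in> {1..q} \<Longrightarrow> place K (P i) \<and> 0 < P i (x - \<alpha> i)"
begin

definition Q :: "('a \<Rightarrow> int) list" where
  "Q = vinf # map P [1..<m + 1]"

lemma length_Q: "length Q = m + 1"
  by (simp add: Q_def)

lemma Q_0: "Q ! 0 = vinf" and Q_P: "u \<in> {1..m} \<Longrightarrow> Q ! u = P u"
  by (auto simp: Q_def nth_Cons' simp del: upt_Suc)

lemma set_Q: "set Q = {vinf} \<union> P ` {1..m}"
  by (auto simp: Q_def)

lemma weights_P: "i \<in> {1..q} \<Longrightarrow> has_weights (P i) 1 (\<lambda>ij p. wt_zero ij (int (order (\<alpha> i) p)))"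
  using weights_at_zero[of "P i" "\<alpha> i"] \<alpha>_root P has_weights_normalized by blast

lemma P_unique: "place K v \<Longrightarrow> i \<in> {1..q} \<Longrightarrow> 0 < v (x - \<alpha> i) \<Longrightarrow> v = P i"
  using weights_at_zero[of v "\<alpha> i"] \<alpha>_root weights_P has_weights_unique by blast

text \<open>
  At the place \<open>Q ! u\<close> a product of \<open>z\<^bsup>i\<^esup> y\<^bsup>j\<^esup>\<close> with a rational function of \<open>x\<close> of degree \<open>d\<close> and
  of order \<open>e l\<close> at \<open>\<alpha> l\<close> has the following value.
\<close>

definition wt :: "nat \<times> nat \<Rightarrow> int \<Rightarrow> (nat \<Rightarrow> int) \<Rightarrow> nat \<Rightarrow> int" where
  "wt ij d e u = (if u = 0 then wt_inf ij d else wt_zero ij (e u))"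

lemma wt_separates: "ij \<in> exponents \<Longrightarrow> kl \<in> exponents \<Longrightarrow> wt ij d e u = wt kl d' e' u \<Longrightarrow> ij = kl"
  by (auto simp: wt_def split: if_splits intro: wt_inf_separates wt_zero_separates)

lemma slope_pos: "0 < (int q + 1) * int M"
  using M_pos by simp

lemma wt_inf_less_iff: "wt_inf ij d < wt_inf ij d' \<longleftrightarrow> d' < d"
  and wt_inf_eq_iff: "wt_inf ij d = wt_inf ij d' \<longleftrightarrow> d = d'"
  using slope_pos M_pos by (auto simp: wt_inf_def mult_less_cancel_left_pos)

lemma wt_zero_less_iff: "wt_zero ij d < wt_zero ij d' \<longleftrightarrow> d < d'"
  and wt_zero_eq_iff: "wt_zero ij d = wt_zero ij d' \<longleftrightarrow> d = d'"
  using slope_pos M_pos by (auto simp: wt_zero_def mult_less_cancel_left_pos)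

lemma weights_Q:
  "u \<le> m \<Longrightarrow> has_weights (Q ! u) 1 (\<lambda>ij p. wt ij (int (degree p)) (\<lambda>l. int (order (\<alpha> l) p)) u)"
  using weights_inf weights_P[of u] m by (cases "u = 0") (auto simp: wt_def Q_0 Q_P)

lemma place_Q: "u \<le> m \<Longrightarrow> place K (Q ! u)"
  using weights_Q by (auto simp: has_weights_def)

lemma origin_exponents: "(0, 0) \<in> exponents"
  using M_pos by (simp add: exponents_def)

lemma linear_poly: "l \<in> {1..q} \<Longrightarrow> [:- \<alpha> l, 1:] \<in> polys" "x - \<alpha> l = trm (0, 0) [:- \<alpha> l, 1:]"
  using \<alpha>_root by (auto simp: polys_pCons polys_0 K_1 K_uminus trm_def)

lemma x_minus_nonzero: "l \<in> {1..q} \<Longrightarrow> x - \<alpha> l \<noteq> 0"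
  using weights_inf linear_poly[of l] origin_exponents unfolding has_weights_def by force

lemma order_linear: "order a [:- b, 1:] = (if a = (b :: 'a) then 1 else 0)"
  using order_power_n_n[of b 1] by (auto intro: order_0I)

lemma value_x_minus:
  assumes u: "u \<le> m" and l: "l \<in> {1..q}"
  shows "(Q ! u) (x - \<alpha> l) =
    (if u = 0 then - ((int q + 1) * int M) else if u = l then (int q + 1) * int M else 0)"
proof -
  have "(Q ! u) (x - \<alpha> l) = wt (0, 0) (int (degree [:- \<alpha> l, 1:])) (\<lambda>k. int (order (\<alpha> k) [:- \<alpha> l, 1:])) u"
    using weights_Q[OF u] linear_poly(1)[OF l] linear_poly(2)[of l] origin_exponents unfolding has_weights_def by auto
  moreover have "\<alpha> u = \<alpha> l \<longleftrightarrow> u = l" if "u \<noteq> 0"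
    using that u l m by (intro inj_on_eq_iff[OF \<alpha>_inj]) auto
  ultimately show ?thesis
    by (auto simp: wt_def wt_inf_def wt_zero_def order_linear)
qed

lemma value_x_minus_outside:
  assumes "place K v" "v \<notin> set Q" "l \<in> {1..m}"
  shows "v (x - \<alpha> l) = 0"
proof -
  have l: "l \<in> {1..q}"
    using assms m by auto
  have "0 \<le> v x"
    using place_inf_unique[of v] assms by (force simp: set_Q)
  then have "0 \<le> v (x + - \<alpha> l)"
    using \<alpha>_root[OF l] place_const[OF assms(1) K_uminus, of "\<alpha> l"]
    by (intro place_nonneg_add[OF assms(1)]) auto
  moreover have "\<not> 0 < v (x - \<alpha> l)"
    using P_unique[OF assms(1) l] assms by (auto simp: set_Q)
  ultimately show ?thesis
    by simp
qed

text \<open>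
  The building block for prescribing orders at the points: \<open>x - \<alpha>\<^sub>l\<close> has no zero but \<open>P\<^sub>l\<close> and no
  pole but infinity.
\<close>

definition G :: "(nat \<Rightarrow> int) \<Rightarrow> 'a" where
  "G e = (\<Prod>l=1..m. (x - \<alpha> l) powi e l)"

lemma G_nonzero: "G e \<noteq> 0"
  using x_minus_nonzero m by (auto simp: G_def prod_zero_iff)

lemma place_G: "place K v \<Longrightarrow> v (G e) = (\<Sum>l=1..m. e l * v (x - \<alpha> l))"
proof -
  assume v: "place K v"
  have ne: "x - \<alpha> l \<noteq> 0" if "l \<in> {1..m}" for l
    using that x_minus_nonzero m by auto
  have "v (G e) = (\<Sum>l=1..m. v ((x - \<alpha> l) powi e l))"
    unfolding G_def using ne by (intro place_prod[OF v]) (auto simp: power_int_eq_0_iff)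
  then show ?thesis
    using ne by (simp add: place_powi[OF v])
qed

lemma wt_add_G:
  assumes u: "u \<le> m"
  shows "wt ij (d + (\<Sum>l=1..m. e l)) (\<lambda>l. f l + e l) u = wt ij d f u + (Q ! u) (G e)"
proof -
  have G: "(Q ! u) (G e) = (\<Sum>l=1..m. e l * (if u = 0 then - ((int q + 1) * int M)
      else if u = l then (int q + 1) * int M else 0))"
    unfolding place_G[OF place_Q[OF u]] using value_x_minus[OF u] m by (intro sum.cong) auto
  show ?thesis
  proof (cases "u = 0")
    case True
    have "(Q ! u) (G e) = (\<Sum>l=1..m. e l) * - ((int q + 1) * int M)"
      unfolding sum_distrib_right G using True by simp
    then show ?thesis
      using True by (simp add: wt_def wt_inf_def algebra_simps)
  next
    case False
    have "(Q ! u) (G e) = (\<Sum>l=1..m. if l = u then e l * ((int q + 1) * int M) else 0)"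
      unfolding G using False by (intro sum.cong) auto
    also have "\<dots> = e u * ((int q + 1) * int M)"
      using u False by (simp add: sum.delta)
    finally show ?thesis
      using False by (simp add: wt_def wt_zero_def algebra_simps)
  qed
qed

definition pole_vec :: "nat \<times> nat \<Rightarrow> int \<Rightarrow> (nat \<Rightarrow> int) \<Rightarrow> int list" where
  "pole_vec ij d e = map (\<lambda>u. - wt ij d e u) [0..<m + 1]"

lemma length_pole_vec: "length (pole_vec ij d e) = m + 1"
  and nth_pole_vec: "u \<le> m \<Longrightarrow> pole_vec ij d e ! u = - wt ij d e u"
  by (simp_all add: pole_vec_def del: upt_Suc)

lemma term_in_semigroup:
  assumes ij: "ij \<in> exponents" and p: "p \<in> polys" "p \<noteq> 0"
  shows "pole_vec ij (int (degree p) + (\<Sum>l=1..m. e l)) (\<lambda>l. int (order (\<alpha> l) p) + e l)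
    \<in> gen_semigroup K Q"
proof -
  define g where "g = trm ij p * G e"
  have t0: "trm ij p \<noteq> 0"
    using weights_inf ij p unfolding has_weights_def by auto
  have g0: "g \<noteq> 0"
    using t0 G_nonzero by (simp add: g_def)
  have g: "v g = v (trm ij p) + v (G e)" if "place K v" for v
    unfolding g_def using t0 G_nonzero by (intro place_mult[OF that])
  have "pole_vec ij (int (degree p) + (\<Sum>l=1..m. e l)) (\<lambda>l. int (order (\<alpha> l) p) + e l) =
      map (\<lambda>v. - v g) Q"
  proof (rule nth_equalityI)
    fix u assume "u < length (pole_vec ij (int (degree p) + (\<Sum>l=1..m. e l)) (\<lambda>l. int (order (\<alpha> l) p) + e l))"
    then have u: "u \<le> m"
      by (simp add: length_pole_vec)
    have "(Q ! u) (trm ij p) = wt ij (int (degree p)) (\<lambda>l. int (order (\<alpha> l) p)) u"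
      using weights_Q[OF u] ij p unfolding has_weights_def by auto
    then have "(Q ! u) g = wt ij (int (degree p) + (\<Sum>l=1..m. e l)) (\<lambda>l. int (order (\<alpha> l) p) + e l) u"
      unfolding wt_add_G[OF u] g[OF place_Q[OF u]] by simp
    then show "pole_vec ij (int (degree p) + (\<Sum>l=1..m. e l)) (\<lambda>l. int (order (\<alpha> l) p) + e l) ! u =
        map (\<lambda>v. - v g) Q ! u"
      using u by (simp add: nth_pole_vec length_Q)
  qed (simp add: length_pole_vec length_Q)
  moreover have "0 \<le> v g" if v: "place K v" "v \<notin> set Q" for v
  proof -
    have vx: "0 \<le> v x"
      using place_inf_unique[of v] v by (force simp: set_Q)
    then have "0 \<le> v y" "0 \<le> v z"
      using pole_iff[OF v(1)] by force+
    then have "0 \<le> v (trm ij p)"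
      unfolding trm_def using vx p(1) v(1)
      by (intro place_nonneg_mult[OF v(1)] place_nonneg_power[OF v(1)] place_poly_nonneg[OF v(1)])
    moreover have "v (G e) = 0"
      using value_x_minus_outside[OF v] by (simp add: place_G[OF v(1)])
    ultimately show ?thesis
      by (simp add: g[OF v(1)])
  qed
  ultimately show ?thesis
    unfolding gen_semigroup_def using g0 by blast
qed

lemma monomial_in_semigroup:
  assumes "ij \<in> exponents"
  shows "pole_vec ij (\<Sum>l=1..m. e l) e \<in> gen_semigroup K Q"
  using term_in_semigroup[OF assms polys_1, of e] by (simp add: order_0I)

text \<open>
  Multiplying by a power of the polynomial in \<open>x\<close> with zeros \<open>\<alpha> 1, \<dots>, \<alpha> m\<close> moves a function whose
  poles lie in \<open>Q\<close> into \<open>A\<close>. Its normal form shows that the pole vector is the componentwise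
  maximum of pole vectors of single terms.
\<close>

lemma semigroup_decomposition:
  assumes "\<gamma> \<in> gen_semigroup K Q"
  obtains I d e where "I \<subseteq> exponents"
    and "\<And>ij. ij \<in> I \<Longrightarrow> (\<Sum>l=1..m. e ij l) \<le> d ij"
    and "\<And>ij. ij \<in> I \<Longrightarrow> pole_vec ij (d ij) (e ij) \<in> gen_semigroup K Q"
    and "\<And>u. u \<le> m \<Longrightarrow> \<exists>ij\<in>I. \<gamma> ! u = - wt ij (d ij) (e ij) u"
    and "\<And>u ij. u \<le> m \<Longrightarrow> ij \<in> I \<Longrightarrow> - wt ij (d ij) (e ij) u \<le> \<gamma> ! u"
proof -
  obtain h where h: "h \<noteq> 0" "\<gamma> = map (\<lambda>v. - v h) Q"
      "\<And>v. place K v \<Longrightarrow> v \<notin> set Q \<Longrightarrow> 0 \<le> v h"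
    using assms by (auto simp: gen_semigroup_def)
  \<comment> \<open>A crude bound on the pole orders, large enough to clear them at all \<open>P l\<close> at once.\<close>
  define N where "N = (\<Sum>l=1..m. \<bar>P l h\<bar>)"
  have N: "\<bar>P l h\<bar> \<le> N" if "l \<in> {1..m}" for l
    unfolding N_def using that by (intro member_le_sum) auto
  define h' where "h' = h * G (\<lambda>_. N)"
  have h'0: "h' \<noteq> 0"
    using h G_nonzero by (simp add: h'_def)
  have h': "v h' = v h + v (G (\<lambda>_. N))" if "place K v" for v
    unfolding h'_def using h G_nonzero by (intro place_mult[OF that])
  have "h' \<in> A"
  proof (rule regular_imp_in_A)
    fix v assume v: "place K v" "v \<noteq> vinf"
    show "0 \<le> v h'"
    proof (cases "v \<in> set Q")
      case False
      then show ?thesis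
        using h(3)[OF v(1)] value_x_minus_outside[OF v(1)] by (simp add: h'[OF v(1)] place_G[OF v(1)])
    next
      case True
      then obtain u where u: "u \<in> {1..m}" "v = Q ! u"
        using v(2) Q_P by (auto simp: set_Q)
      have "v (G (\<lambda>_. N)) = wt (0, 0) (0 + (\<Sum>l=1..m. N)) (\<lambda>l. 0 + N) u - wt (0, 0) 0 (\<lambda>l. 0) u"
        unfolding u(2) using u(1) by (subst wt_add_G) auto
      also have "\<dots> = (int q + 1) * int M * N"
        using u by (simp add: wt_def wt_zero_def)
      finally have "v h' = P u h + (int q + 1) * int M * N"
        using h'[OF v(1)] u Q_P by simp
      moreover have "0 \<le> N" "\<bar>P u h\<bar> \<le> N"
        using N[OF u(1)] by auto
      moreover have "1 * N \<le> (int q + 1) * int M * N"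
        using slope_pos \<open>0 \<le> N\<close> by (intro mult_right_mono) auto
      ultimately show ?thesis
        by linarith
    qed
  qed
  then obtain p where p: "\<And>ij. p ij \<in> polys" "h' = (\<Sum>ij\<in>exponents. trm ij (p ij))"
    using normal_form by blast
  define I where "I = {ij \<in> exponents. p ij \<noteq> 0}"
  define d where "d ij = int (degree (p ij)) + (\<Sum>l=1..m. - N)" for ij
  define e where "e ij l = int (order (\<alpha> l) (p ij)) + (- N)" for ij l
  have wt_h: "wt ij (d ij) (e ij) u = wt ij (int (degree (p ij))) (\<lambda>l. int (order (\<alpha> l) (p ij))) u + (Q ! u) h - (Q ! u) h'"
    if "u \<le> m" for ij u
  proof -
    have "(Q ! u) (G (\<lambda>_. - N)) = - (Q ! u) (G (\<lambda>_. N))"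
      by (simp add: place_G[OF place_Q[OF that]] sum_negf)
    then show ?thesis
      unfolding d_def e_def wt_add_G[OF that] h'[OF place_Q[OF that]] by simp
  qed
  have \<gamma>: "\<gamma> ! u = - (Q ! u) h" if "u \<le> m" for u
    using that by (simp add: h(2) length_Q)
  have min: "\<exists>ij\<in>I. (Q ! u) h = wt ij (d ij) (e ij) u \<and> (\<forall>kl\<in>I. wt ij (d ij) (e ij) u \<le> wt kl (d kl) (e kl) u)"
    if u: "u \<le> m" for u
  proof -
    obtain ij where "ij \<in> exponents" "p ij \<noteq> 0"
        "(Q ! u) h' = wt ij (int (degree (p ij))) (\<lambda>l. int (order (\<alpha> l) (p ij))) u"
        "\<And>kl. kl \<in> exponents \<Longrightarrow> p kl \<noteq> 0 \<Longrightarrow>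
          wt ij (int (degree (p ij))) (\<lambda>l. int (order (\<alpha> l) (p ij))) u \<le>
          wt kl (int (degree (p kl))) (\<lambda>l. int (order (\<alpha> l) (p kl))) u"
      using has_weights_normal_form[OF weights_Q[OF u] p h'0] by auto
    then show ?thesis
      unfolding wt_h[OF u] I_def by (intro bexI[of _ ij]) auto
  qed
  show thesis
  proof (rule that[of I e d])
    show "I \<subseteq> exponents"
      by (auto simp: I_def)
    show "(\<Sum>l=1..m. e ij l) \<le> d ij" if "ij \<in> I" for ij
    proof -
      have "inj_on \<alpha> {1..m}"
        using m by (intro inj_on_subset[OF \<alpha>_inj]) auto
      then have "(\<Sum>l=1..m. order (\<alpha> l) (p ij)) = (\<Sum>a\<in>\<alpha> ` {1..m}. order a (p ij))"
        by (simp add: sum.reindex)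
      also have "\<dots> \<le> degree (p ij)"
        using that by (intro sum_order_le_degree_subset) (auto simp: I_def)
      finally have "(\<Sum>l=1..m. int (order (\<alpha> l) (p ij))) \<le> int (degree (p ij))"
        by (simp flip: of_nat_sum)
      then show ?thesis
        unfolding d_def e_def sum.distrib by simp
    qed
    show "pole_vec ij (d ij) (e ij) \<in> gen_semigroup K Q" if "ij \<in> I" for ij
      using that p(1) unfolding d_def e_def by (intro term_in_semigroup) (auto simp: I_def)
    show "\<exists>ij\<in>I. \<gamma> ! u = - wt ij (d ij) (e ij) u" if "u \<le> m" for u
      using min[OF that] \<gamma>[OF that] by auto
    show "- wt ij (d ij) (e ij) u \<le> \<gamma> ! u" if "u \<le> m" "ij \<in> I" for u ij
      using min[OF that(1)] \<gamma>[OF that(1)] that(2) by auto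
  qed
qed

text \<open>A nonempty \<open>J\<close> is a singleton or has at least two elements.\<close>

lemma absolute_maximal_iff:
  "absolute_maximal K Q \<gamma> \<longleftrightarrow>
    \<gamma> \<in> gen_semigroup K Q \<and> (\<forall>J. J \<subset> {..m} \<and> J \<noteq> {} \<longrightarrow> nabla K Q J \<gamma> = {})"
    (is "?L \<longleftrightarrow> ?R")
proof
  have atMost: "{..<length Q} = {..m}"
    by (auto simp: length_Q)
  show ?R if L: ?L
  proof (intro conjI allI impI)
    show "\<gamma> \<in> gen_semigroup K Q"
      using L by (simp add: absolute_maximal_def maximal_elem_def)
    fix J assume J: "J \<subset> {..m} \<and> J \<noteq> {}"
    then have "finite J" "card J \<noteq> 0"
      using finite_subset[of J "{..m}"] by auto
    then consider "card J = 1" | "2 \<le> card J"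
      by linarith
    then show "nabla K Q J \<gamma> = {}"
    proof cases
      case 1
      then obtain i where "J = {i}"
        by (auto simp: card_1_singleton_iff)
      then show ?thesis
        using L J by (auto simp: absolute_maximal_def maximal_elem_def length_Q)
    next
      case 2
      then show ?thesis
        using L J atMost by (simp add: absolute_maximal_def)
    qed
  qed
  show ?L if R: ?R
    unfolding absolute_maximal_def maximal_elem_def atMost
  proof (intro conjI allI impI)
    fix i assume "i < length Q"
    then have "{i} \<subset> {..m}"
      using m by (auto simp: length_Q psubset_eq set_eq_iff intro: exI[of _ 0] exI[of _ 1])
    then show "nabla K Q {i} \<gamma> = {}"
      using R by blast
  next
    fix J :: "nat set" assume "J \<subset> {..m} \<and> 2 \<le> card J"
    then show "nabla K Q J \<gamma> = {}"
      using R by (metis card.empty not_numeral_le_zero)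
  qed (use R in blast)
qed

text \<open>
  Suppose that \<open>nabla\<close> contained the pole vector of some function. A coordinate where the two
  vectors agree identifies the same \<open>(i, j)\<close>, so one of its terms \<open>z\<^bsup>i\<^esup> y\<^bsup>j\<^esup> r(x)\<close> competes with
  the monomial. Then \<open>r\<close> would have a degree that is too small for its orders at the points \<open>\<alpha> l\<close>.
\<close>

lemma monomial_absolute_maximal:
  assumes ij: "ij \<in> exponents"
  shows "absolute_maximal K Q (pole_vec ij (\<Sum>l=1..m. e l) e)"
  unfolding absolute_maximal_iff
proof (intro conjI allI impI monomial_in_semigroup[OF ij])
  fix J assume J: "J \<subset> {..m} \<and> J \<noteq> {}"
  let ?s = "\<Sum>l=1..m. e l"
  show "nabla K Q J (pole_vec ij ?s e) = {}"
  proof (rule ccontr)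
    assume "nabla K Q J (pole_vec ij ?s e) \<noteq> {}"
    then obtain \<beta> where nabla: "\<beta> \<in> nabla K Q J (pole_vec ij ?s e)"
      by blast
    then have \<beta>: "\<beta> \<in> gen_semigroup K Q"
      by (simp add: nabla_def)
    have eq: "\<beta> ! u = - wt ij ?s e u" if "u \<in> J" for u
      using nabla that J by (auto simp: nabla_def nth_pole_vec subset_eq psubset_eq)
    have less: "\<beta> ! u < - wt ij ?s e u" if "u \<le> m" "u \<notin> J" for u
      using nabla that by (auto simp: nabla_def nth_pole_vec length_Q)
    obtain I d f where I: "I \<subseteq> exponents" "\<And>kl. kl \<in> I \<Longrightarrow> (\<Sum>l=1..m. f kl l) \<le> d kl"
      and attained: "\<And>u. u \<le> m \<Longrightarrow> \<exists>kl\<in>I. \<beta> ! u = - wt kl (d kl) (f kl) u"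
      and bound: "\<And>u kl. u \<le> m \<Longrightarrow> kl \<in> I \<Longrightarrow> - wt kl (d kl) (f kl) u \<le> \<beta> ! u"
      using semigroup_decomposition[OF \<beta>] by metis
    have J_le: "u \<le> m" if "u \<in> J" for u
      using that J by auto
    have same: "ij \<in> I \<and> wt ij (d ij) (f ij) u = wt ij ?s e u" if u: "u \<in> J" for u
    proof -
      obtain kl where kl: "kl \<in> I" "\<beta> ! u = - wt kl (d kl) (f kl) u"
        using attained[OF J_le[OF u]] by auto
      then have "wt ij ?s e u = wt kl (d kl) (f kl) u"
        using eq[OF u] by simp
      moreover from this have "ij = kl"
        using wt_separates ij I(1) kl(1) by blast
      ultimately show ?thesis
        using kl(1) by simp
    qed
    then have ij_I: "ij \<in> I"
      using J by auto
    have greater: "wt ij ?s e u < wt ij (d ij) (f ij) u" if "u \<le> m" "u \<notin> J" for u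
      using less[OF that] bound[OF that(1) ij_I] by simp
    have f_eq: "f ij l = e l" if "l \<in> {1..m}" "l \<in> J" for l
      using same[OF that(2)] that(1) by (simp add: wt_def wt_zero_eq_iff)
    have f_gr: "e l < f ij l" if "l \<in> {1..m}" "l \<notin> J" for l
      using greater[of l] that by (simp add: wt_def wt_zero_less_iff)
    have le: "e l \<le> f ij l" if "l \<in> {1..m}" for l
      using f_eq[OF that] f_gr[OF that] by (cases "l \<in> J") auto
    have sum_le: "?s \<le> (\<Sum>l=1..m. f ij l)"
      using le by (rule sum_mono)
    show False
    proof (cases "0 \<in> J")
      case True
      then have "d ij = ?s"
        using same[OF True] by (simp add: wt_def wt_inf_eq_iff)
      obtain l where "l \<le> m" "l \<notin> J"
        using J by auto
      then have "l \<in> {1..m}"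
        using True by (cases l) auto
      then have "\<exists>l\<in>{1..m}. e l < f ij l"
        using f_gr \<open>l \<notin> J\<close> by blast
      then have "?s < (\<Sum>l=1..m. f ij l)"
        using le by (intro sum_strict_mono_ex1) auto
      then show False
        using I(2)[OF ij_I] \<open>d ij = ?s\<close> by simp
    next
      case False
      then have "d ij < ?s"
        using greater[of 0] by (simp add: wt_def wt_inf_less_iff)
      then show False
        using I(2)[OF ij_I] sum_le by simp
    qed
  qed
qed

text \<open>
  Conversely, the term that attains the first coordinate of an absolute maximal vector must attain
  all of them. If its rational function of \<open>x\<close> had a zero outside \<open>\<alpha> 1, \<dots>, \<alpha> m\<close>, removing this
  zero would lower the first coordinate alone.
\<close>

lemma absolute_maximal_imp_monomial:
  assumes \<gamma>: "absolute_maximal K Q \<gamma>"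
  shows "\<exists>ij\<in>exponents. \<exists>e. \<gamma> = pole_vec ij (\<Sum>l=1..m. e l) e"
proof -
  have in_sg: "\<gamma> \<in> gen_semigroup K Q"
    and max: "\<And>J. J \<subset> {..m} \<Longrightarrow> J \<noteq> {} \<Longrightarrow> nabla K Q J \<gamma> = {}"
    using \<gamma> unfolding absolute_maximal_iff by auto
  obtain I d e where I: "I \<subseteq> exponents" "\<And>ij. ij \<in> I \<Longrightarrow> (\<Sum>l=1..m. e ij l) \<le> d ij"
      "\<And>ij. ij \<in> I \<Longrightarrow> pole_vec ij (d ij) (e ij) \<in> gen_semigroup K Q"
    and attained: "\<And>u. u \<le> m \<Longrightarrow> \<exists>ij\<in>I. \<gamma> ! u = - wt ij (d ij) (e ij) u"
    and bound: "\<And>u ij. u \<le> m \<Longrightarrow> ij \<in> I \<Longrightarrow> - wt ij (d ij) (e ij) u \<le> \<gamma> ! u"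
    using semigroup_decomposition[OF in_sg] by metis
  obtain ij where ij: "ij \<in> I" "\<gamma> ! 0 = - wt ij (d ij) (e ij) 0"
    using attained[of 0] by auto
  define J where "J = {u. u \<le> m \<and> \<gamma> ! u = - wt ij (d ij) (e ij) u}"
  have "0 \<in> J" "J \<subseteq> {..m}"
    using ij by (auto simp: J_def)
  have "pole_vec ij (d ij) (e ij) \<in> nabla K Q J \<gamma>"
    unfolding nabla_def
  proof (intro CollectI conjI ballI I(3)[OF ij(1)])
    fix u assume "u \<in> {..<length Q} - J"
    then have "u \<le> m" "\<gamma> ! u \<noteq> - wt ij (d ij) (e ij) u"
      by (auto simp: length_Q J_def)
    then show "pole_vec ij (d ij) (e ij) ! u < \<gamma> ! u"
      using bound[of u ij] ij by (simp add: nth_pole_vec)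
  qed (auto simp: J_def nth_pole_vec)
  then have "J = {..m}"
    using max[of J] \<open>0 \<in> J\<close> \<open>J \<subseteq> {..m}\<close> by blast
  then have nth: "\<gamma> ! u = - wt ij (d ij) (e ij) u" if "u \<le> m" for u
    using that by (auto simp: J_def)
  let ?s = "\<Sum>l=1..m. e ij l"
  have "\<not> ?s < d ij"
  proof
    assume less: "?s < d ij"
    have "pole_vec ij ?s (e ij) \<in> nabla K Q {1..m} \<gamma>"
      unfolding nabla_def
    proof (intro CollectI conjI ballI monomial_in_semigroup)
      show "ij \<in> exponents"
        using ij I by auto
      show "pole_vec ij ?s (e ij) ! u = \<gamma> ! u" if "u \<in> {1..m}" for u
        using that by (simp add: nth nth_pole_vec wt_def)
      fix u assume "u \<in> {..<length Q} - {1..m}"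
      then have "u = 0"
        by (auto simp: length_Q)
      then show "pole_vec ij ?s (e ij) ! u < \<gamma> ! u"
        using less by (simp add: nth nth_pole_vec wt_def wt_inf_less_iff)
    qed
    moreover have "{1..m} \<subset> {..m}" "{1..m} \<noteq> {}"
      using m by (auto simp: psubset_eq set_eq_iff intro: exI[of _ 0])
    ultimately show False
      using max by blast
  qed
  then have "d ij = ?s"
    using I(2)[OF ij(1)] by simp
  have "length \<gamma> = m + 1"
    using in_sg by (auto simp: gen_semigroup_def length_Q)
  then have "\<gamma> = pole_vec ij ?s (e ij)"
    using nth \<open>d ij = ?s\<close> by (intro nth_equalityI) (auto simp: length_pole_vec nth_pole_vec)
  then show ?thesis
    using ij I by blast
qed

text \<open>
  The vector of the statement with indices \<open>i\<close>, \<open>j\<close>, \<open>k\<close> belongs to \<open>z\<^bsup>M - j\<^esup> y\<^bsup>q - i\<^esup> \<Prod>\<^sub>l (x -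
  \<alpha>\<^sub>l)\<^bsup>- k (l + 1) - 1\<^esup>\<close>; one is subtracted because \<open>(M - j) + (q - i) M = (q + 1) M - (i M + j)\<close>,
  and the argument \<open>l + 1\<close> counts the place at infinity as the first coordinate.
\<close>

lemma beta_vec_eq_pole_vec:
  assumes "i = int q - int b" "j = int M - int a"
    and e: "\<And>l. l \<in> {1..m} \<Longrightarrow> e l = - k (l + 1) - 1"
  shows "beta_vec q M m i j k = pole_vec (a, b) (\<Sum>l=1..m. e l) e"
proof (rule nth_equalityI)
  show "length (beta_vec q M m i j k) = length (pole_vec (a, b) (\<Sum>l=1..m. e l) e)"
    by (simp add: beta_vec_def length_pole_vec del: upt_Suc)
next
  fix u assume "u < length (beta_vec q M m i j k)"
  then have u: "u \<le> m"
    by (simp add: beta_vec_def del: upt_Suc)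
  have "(\<Sum>l=1..m. e l) = (\<Sum>l=1..m. - k (l + 1) - 1)"
    using e by (intro sum.cong) auto
  also have "\<dots> = - (\<Sum>l=1..m. k (Suc l)) - int m"
    by (simp add: sum_subtractf sum_negf)
  also have "(\<Sum>l=1..m. k (Suc l)) = (\<Sum>l=2..m + 1. k l)"
    using sum.shift_bounds_cl_Suc_ivl[of k 1 m] by (simp only: Suc_1 Suc_eq_plus1[symmetric])
  finally have sum: "(\<Sum>l=1..m. e l) = - (\<Sum>l=2..m + 1. k l) - int m" .
  show "beta_vec q M m i j k ! u = pole_vec (a, b) (\<Sum>l=1..m. e l) e ! u"
  proof (cases u)
    case 0
    then show ?thesis
      unfolding sum
      by (simp add: nth_pole_vec beta_vec_def wt_def wt_inf_def assms(1,2) power2_eq_square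
          power3_eq_cube algebra_simps)
  next
    case (Suc l)
    then have "beta_vec q M m i j k ! u = k (u + 1) * (int q + 1) * int M + i * int M + j"
      using u by (simp add: beta_vec_def del: upt_Suc)
    also have "k (u + 1) = - e u - 1"
      using e[of u] u Suc by simp
    also have "(- e u - 1) * (int q + 1) * int M + i * int M + j = - wt_zero (a, b) (e u)"
      by (simp add: wt_zero_def assms(1,2) algebra_simps)
    finally show ?thesis
      using u Suc by (simp add: nth_pole_vec wt_def)
  qed
qed

text \<open>
  The pair \<open>(q, M)\<close> left out of the index set belongs to the products of powers of the \<open>x - \<alpha>\<^sub>l\<close>
  alone. Their pole vector is \<open>((q + 1) M \<Sum>\<^sub>l e l, - (q + 1) M e 1, \<dots>, - (q + 1) M e m)\<close>, which is
  nonnegative only if it is zero. No other monomial has the pole vector zero.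
\<close>

theorem Gamma_eq:
  "Gamma K Q =
    {beta_vec q M m i j k | i j k. (i, j) \<in> index_set q M \<and> nonneg_vec (beta_vec q M m i j k)}"
  (is "_ = ?B")
proof (intro equalityI subsetI)
  fix \<gamma> assume "\<gamma> \<in> Gamma K Q"
  then have max: "absolute_maximal K Q \<gamma>" and nonneg: "nonneg_vec \<gamma>"
    and ne: "\<gamma> \<noteq> replicate (m + 1) 0"
    by (auto simp: Gamma_def Gamma_hat_def length_Q)
  obtain a b e where ab: "(a, b) \<in> exponents" and \<gamma>: "\<gamma> = pole_vec (a, b) (\<Sum>l=1..m. e l) e"
    using absolute_maximal_imp_monomial[OF max] by auto
  \<comment> \<open>All \<open>e l\<close> would be nonpositive while their sum is nonnegative.\<close>
  have "(a, b) \<noteq> (0, 0)"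
  proof
    assume 0: "(a, b) = (0, 0)"
    have nn: "0 \<le> - wt (0, 0) (\<Sum>l=1..m. e l) e u" if "u \<le> m" for u
      using nonneg that nth_mem[of u \<gamma>] unfolding \<gamma> 0 nonneg_vec_def
      by (metis length_pole_vec less_Suc_eq_le nth_pole_vec Suc_eq_plus1 nth_mem)
    have e: "e l \<le> 0" if "l \<in> {1..m}" for l
      using nn[of l] that slope_pos by (auto simp: wt_def wt_zero_def mult_le_0_iff)
    moreover have "0 \<le> (\<Sum>l=1..m. e l)"
      using nn[of 0] slope_pos by (auto simp: wt_def wt_inf_def zero_le_mult_iff)
    ultimately have s: "(\<Sum>l=1..m. e l) = 0"
      using sum_nonpos[of "{1..m}" e] by force
    then have "e l = 0" if "l \<in> {1..m}" for l
      using sum_nonneg_eq_0_iff[of "{1..m}" "\<lambda>l. - e l"] e that by (auto simp: sum_negf)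
    then have "\<gamma> = replicate (m + 1) 0"
      unfolding \<gamma> 0 s
      by (intro nth_equalityI) (auto simp: length_pole_vec nth_pole_vec wt_def wt_inf_def wt_zero_def
          simp del: replicate_Suc)
    then show False
      using ne by simp
  qed
  then have "(int q - int b, int M - int a) \<in> index_set q M"
    using ab by (auto simp: index_set_def exponents_def)
  moreover have "\<gamma> = beta_vec q M m (int q - int b) (int M - int a) (\<lambda>l. - e (l - 1) - 1)"
    unfolding \<gamma> by (rule beta_vec_eq_pole_vec[symmetric]) auto
  ultimately show "\<gamma> \<in> ?B"
    using nonneg by blast
next
  fix \<gamma> assume "\<gamma> \<in> ?B"
  then obtain i j k where ij: "(i, j) \<in> index_set q M" and nonneg: "nonneg_vec \<gamma>"
    and \<gamma>: "\<gamma> = beta_vec q M m i j k"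
    by auto
  define a where "a = nat (int M - j)"
  define b where "b = nat (int q - i)"
  define e where "e l = - k (l + 1) - 1" for l
  have i: "i = int q - int b" and j: "j = int M - int a" and ab: "(a, b) \<in> exponents" "(a, b) \<noteq> (0, 0)"
    using ij by (auto simp: index_set_def a_def b_def exponents_def)
  have \<gamma>': "\<gamma> = pole_vec (a, b) (\<Sum>l=1..m. e l) e"
    unfolding \<gamma> by (rule beta_vec_eq_pole_vec[OF i j]) (simp add: e_def)
  have "\<gamma> \<noteq> replicate (m + 1) 0"
  proof
    assume "\<gamma> = replicate (m + 1) 0"
    then have "wt (a, b) (\<Sum>l=1..m. e l) e 1 = wt (0, 0) 0 (\<lambda>_. 0) 1"
      using m nth_pole_vec[of 1 "(a, b)" "\<Sum>l=1..m. e l" e] unfolding \<gamma>'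
      by (simp add: wt_def wt_zero_def del: replicate_Suc)
    then show False
      using wt_separates[OF ab(1) origin_exponents] ab(2) by blast
  qed
  moreover have "absolute_maximal K Q \<gamma>"
    unfolding \<gamma>' by (rule monomial_absolute_maximal[OF ab(1)])
  ultimately show "\<gamma> \<in> Gamma K Q"
    using nonneg by (simp add: Gamma_def Gamma_hat_def length_Q)
qed

end

theorem corollary4p3:
  fixes q n s M m :: nat
    and K :: "'a::field set" and x y z :: 'a
    and \<alpha> :: "nat \<Rightarrow> 'a"
    and Pinf :: "'a \<Rightarrow> int" and P :: "nat \<Rightarrow> 'a \<Rightarrow> int"
  assumes "primepow q" and "3 \<le> n" and "odd n"
    and "0 < s" and "s dvd (q ^ n + 1) div (q + 1)"
    and "M = (q ^ n + 1) div (s * (q + 1))"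
    and "Y_function_field q n M K x y z"
    and "rational_place K Pinf" and "Pinf x < 0" and "Pinf y < 0" and "Pinf z < 0"
    and "bij_betw \<alpha> {1..q} {a \<in> K. a ^ q + a = 0}"
    and "\<And>i. i \<in> {1..q} \<Longrightarrow>
           rational_place K (P i) \<and> 0 < P i (x - \<alpha> i) \<and> 0 < P i y \<and> 0 < P i z"
    and "1 \<le> m" and "m \<le> q"
  shows "Gamma K (Pinf # map P [1..<m+1]) =
    {beta_vec q M m i j k | i j k. (i, j) \<in> index_set q M \<and> nonneg_vec (beta_vec q M m i j k)}"
proof -
  \<comment> \<open>\<open>M\<close> divides \<open>q\<^bsup>n\<^esup> + 1\<close>, hence is prime to \<open>q\<close>; oddness of \<open>n\<close> makes the divisions exact.\<close>
  have "(int q + 1) dvd int q ^ n + 1"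
  proof -
    have "int q - (- 1) dvd int q ^ n - (- 1) ^ n"
      unfolding power_diff_sumr2 by (rule dvd_triv_left)
    then show ?thesis
      using \<open>odd n\<close> by simp
  qed
  then have "int (q + 1) dvd int (q ^ n + 1)"
    by (simp add: add.commute)
  then have "(q + 1) dvd (q ^ n + 1)"
    by (simp only: of_nat_dvd_iff)
  then obtain r where r: "q ^ n + 1 = (q + 1) * r"
    by auto
  then have "(q ^ n + 1) div (q + 1) = r"
    by (metis nonzero_mult_div_cancel_left add_is_0 one_neq_zero)
  then obtain u where u: "r = s * u"
    using assms(5) by auto
  have eq: "q ^ n + 1 = s * (q + 1) * u"
    using r unfolding u by (simp only: ac_simps)
  then have "M = u"
    using assms(4,6) by simp
  then have M: "q ^ n + 1 = s * (q + 1) * M"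
    using eq by simp
  then have "0 < M"
    by (intro gr0I) simp
  have "coprime (q ^ n) (q ^ n + 1)"
    by (rule coprime_add_one_right)
  then have "coprime q (q ^ n + 1)"
    using assms(2) by (simp only: coprime_power_left_iff) simp
  then have "coprime q M"
    unfolding M by simp
  interpret curve_points K q n M x y z Pinf m \<alpha> P
  proof unfold_locales
    show "\<alpha> i \<in> K \<and> \<alpha> i ^ q + \<alpha> i = 0" if "i \<in> {1..q}" for i
      using assms(12) that by (auto simp: bij_betw_def)
    show "place K (P i) \<and> 0 < P i (x - \<alpha> i)" if "i \<in> {1..q}" for i
      using assms(13)[OF that] by (auto simp: rational_place_def)
  qed (use assms \<open>0 < M\<close> \<open>coprime q M\<close> in \<open>auto simp: Y_function_field_def bij_betw_def\<close>)
  show ?thesis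
    using Gamma_eq unfolding Q_def .
qed

end
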